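(* Let $\mathcal{K}\subsetneqq\mathbb{R}^m$ be a regular cone, let $f\in\mathcal{B}_\theta(\mathcal{K})$ for some $\theta\ge1$, let $\mathsf{A}:\mathbb{R}^n\to\mathbb{R}^m$ be a linear operator, and let $h:\mathbb{R}^n\to\mathbb{R}\cup\{+\infty\}$ be proper, closed and convex, with $\mathcal{X}:=\operatorname{dom}h$ nonempty, convex and compact, and $\mathsf{A}(\mathcal{X})\cap\operatorname{dom}f\neq\emptyset$. Let $F(x):=f(\mathsf{A}x)+h(x)$, $F^*:=\min_{x\in\mathbb{R}^n}F(x)$, $d(y):=f^*(y)+h^*(-\mathsf{A}^*y)$, let $y^*$ be a minimizer of $d$ over $\mathbb{R}^m$, and let $R_h:=\max_{x,y\in\mathcal{X}}|h(x)-h(y)|$. Let $\{y^k\}_{k\ge0}$ be the iterates of the mirror descent method (Algorithm 2, described in the context) started from $y^0,z^0$, let $d_k:=d(y^k)-d(y^* )$ be the dual optimality gap, let $\delta_0:=F(z^0)-F^*$ be the initial primal optimality gap, and let $\varepsilon>0$. Let $\mathrm{DGAP}_\varepsilon$ denote the number of iterations required by Algorithm 2 to obtain $d_k\le\varepsilon$. Then $$\mathrm{DGAP}_\varepsilon\le\left\lceil5.3(\delta_0+\theta+R_h)\ln(10.6\,\delta_0)\right\rceil+\left\lceil\frac{24(\theta+R_h)^2}{\varepsilon}\right\rceil .$$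
   Context: A cone $\mathcal{K}\subsetneqq\mathbb{R}^m$ is regular if it is closed, convex, pointed (contains no line) and has nonempty interior. For $\theta\ge1$, $f\in\mathcal{B}_\theta(\mathcal{K})$ means that $f:\mathbb{R}^m\to\mathbb{R}\cup\{+\infty\}$ is a $\theta$-logarithmically-homogeneous (non-degenerate) self-concordant barrier on $\mathcal{K}$: $f$ is convex with $\operatorname{dom}f=\operatorname{int}\mathcal{K}$, is three-times differentiable and strictly convex on $\operatorname{int}\mathcal{K}$, and, with $H(u)$ the Hessian of $f$ at $u$, satisfies: (P1) $|D^3f(u)[w,w,w]|\le2\langle H(u)w,w\rangle^{3/2}$ for all $u\in\operatorname{int}\mathcal{K}$, $w\in\mathbb{R}^m$; (P2) $f(u_k)\to\infty$ for any $\{u_k\}_{k\ge1}\subseteq\operatorname{int}\mathcal{K}$ with $u_k\to u\in\operatorname{bd}\mathcal{K}$; (P3) $f(tu)=f(u)-\theta\ln t$ for all $u\in\operatorname{int}\mathcal{K}$, $t>0$. Notation: $\|w\|_u:=\sqrt{\langle w,H(u)w\rangle}$ for $u\in\operatorname{int}\mathcal{K}$; $\mathsf{A}^*$ is the adjoint of $\mathsf{A}$; $f^*,h^*$ are the Fenchel conjugates of $f,h$ ($w^*(g):=\sup_u\{\langle g,u\rangle-w(u)\}$); $\mathcal{K}^\circ:=\{y\in\mathbb{R}^m:\langle y,u\rangle\le0\ \forall u\in\mathcal{K}\}$ is the polar of $\mathcal{K}$; $f^*$ is a $\theta$-logarithmically-homogeneous self-concordant barrier on $\mathcal{K}^\circ$.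 $D_{f^*}(y,y^k):=f^*(y)-f^*(y^k)-\langle\nabla f^*(y^k),y-y^k\rangle$. Both $F$ and $d$ attain their minima. Algorithm 2. Input: $y^0\in\operatorname{int}\mathcal{K}^\circ$ and $z^0\in\{z\in\mathcal{X}:\mathsf{A}z=\nabla f^*(y^0)\}$. At iteration $k=0,1,\ldots$: 1. Let $s^k\in\partial h^*(-\mathsf{A}^*y^k)$ and define $g^k:=\nabla f^*(y^k)-\mathsf{A}s^k\in\partial d(y^k)$. 2. If $k\ge1$, compute $z^k:=(1-\gamma_{k-1})z^{k-1}+\gamma_{k-1}s^{k-1}$. 3. Compute $\bar G_k:=\langle g^k,y^k\rangle+h(z^k)-h(s^k)$ and $\bar D_k:=\|g^k\|_{\nabla f^*(y^k)}$, and the step-size $\gamma_k:=\min\left\{\frac{\bar G_k}{\bar D_k(\bar G_k+\bar D_k)},1\right\}$. 4. Update $y^{k+1}:=\arg\min_{y\in\mathbb{R}^m}\langle g^k,y\rangle+\gamma_k^{-1}D_{f^*}(y,y^k)$.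
   Formalization: The formal statement adds the hypothesis A(X) ⊆ K (without it the bound fails), replaces a negative right-hand side by 0, reads ln 0 as 0 when δ_0 = 0, and takes R_h as a supremum assumed finite. *)

theory Defs
  imports "HOL-Analysis.Analysis" "HOL-Library.Extended_Nat"
begin

definition regular_cone :: "'a::euclidean_space set \<Rightarrow> bool" where
  "regular_cone K \<longleftrightarrow>
     K \<noteq> UNIV \<and> cone K \<and> closed K \<and> convex K \<and> interior K \<noteq> {} \<and>
     \<not> (\<exists>x v. v \<noteq> 0 \<and> (\<forall>t::real. x + t *\<^sub>R v \<in> K))"

definition polar :: "'a::real_inner set \<Rightarrow> 'a set" where
  "polar K = {y. \<forall>u\<in>K. y \<bullet> u \<le> 0}"

definition effdom :: "('a \<Rightarrow> ereal) \<Rightarrow> 'a set" where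
  "effdom w = {x. w x < \<infinity>}"

definition epi :: "('a \<Rightarrow> ereal) \<Rightarrow> ('a \<times> real) set" where
  "epi w = {(x, r). w x \<le> ereal r}"

definition proper_closed_convex :: "('a::real_normed_vector \<Rightarrow> ereal) \<Rightarrow> bool" where
  "proper_closed_convex w \<longleftrightarrow>
     (\<forall>x. w x \<noteq> -\<infinity>) \<and> effdom w \<noteq> {} \<and> closed (epi w) \<and> convex (epi w)"

definition conjugate :: "('a::real_inner \<Rightarrow> ereal) \<Rightarrow> 'a \<Rightarrow> ereal" where
  "conjugate w g = (SUP u. ereal (g \<bullet> u) - w u)"

definition subdifferential :: "('a::real_inner \<Rightarrow> ereal) \<Rightarrow> 'a \<Rightarrow> 'a set" where
  "subdifferential w y =
     {s. \<bar>w y\<bar> \<noteq> \<infinity> \<and> (\<forall>v. w y + ereal (s \<bullet> (v - y)) \<le> w v)}"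

text \<open>
  The real-valued part of an extended-real-valued function. The derivatives below are only
  meaningful in the interior of the domain, where this function agrees with the original one.
\<close>

abbreviation (input) fin :: "('a \<Rightarrow> ereal) \<Rightarrow> 'a \<Rightarrow> real" where
  "fin w \<equiv> \<lambda>x. real_of_ereal (w x)"

definition grad :: "('a::real_inner \<Rightarrow> ereal) \<Rightarrow> 'a \<Rightarrow> 'a" where
  "grad w u = (THE D. GDERIV (fin w) u :> D)"

definition hess :: "(real^'m \<Rightarrow> ereal) \<Rightarrow> real^'m \<Rightarrow> real^'m^'m" where
  "hess w u = matrix (frechet_derivative (grad w) (at u))"

definition third_deriv :: "(real^'m \<Rightarrow> ereal) \<Rightarrow> real^'m \<Rightarrow> real^'m \<Rightarrow> real" where
  "third_deriv w u v = v \<bullet> (frechet_derivative (hess w) (at u) v *v v)"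

definition local_norm :: "(real^'m \<Rightarrow> ereal) \<Rightarrow> real^'m \<Rightarrow> real^'m \<Rightarrow> real" where
  "local_norm f u w = sqrt (w \<bullet> (hess f u *v w))"

text \<open>The last three conjuncts are self-concordance, the barrier property and \<open>\<theta>\<close>-logarithmic
  homogeneity.\<close>

definition lhscb :: "real \<Rightarrow> (real^'m) set \<Rightarrow> (real^'m \<Rightarrow> ereal) \<Rightarrow> bool" where
  "lhscb \<theta> K f \<longleftrightarrow>
     (\<forall>u. f u \<noteq> -\<infinity>) \<and> convex (epi f) \<and> effdom f = interior K \<and>
     (\<forall>u\<in>interior K. fin f differentiable (at u) \<and> grad f differentiable (at u) \<and>
        hess f differentiable (at u)) \<and>
     (\<forall>u\<in>interior K. \<forall>v\<in>interior K. \<forall>t::real. u \<noteq> v \<longrightarrow> 0 < t \<longrightarrow> t < 1 \<longrightarrow>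
        fin f ((1 - t) *\<^sub>R u + t *\<^sub>R v) < (1 - t) * fin f u + t * fin f v) \<and>
     (\<forall>u\<in>interior K. \<forall>w. \<bar>third_deriv f u w\<bar> \<le> 2 * (w \<bullet> (hess f u *v w)) powr (3/2)) \<and>
     (\<forall>x u. (\<forall>k::nat. x k \<in> interior K) \<longrightarrow> u \<in> frontier K \<longrightarrow> x \<longlonglongrightarrow> u \<longrightarrow>
        (\<lambda>k. f (x k)) \<longlonglongrightarrow> \<infinity>) \<and>
     (\<forall>u\<in>interior K. \<forall>t::real. t > 0 \<longrightarrow> f (t *\<^sub>R u) = f u - ereal (\<theta> * ln t))"

definition primal_obj ::
  "(real^'m \<Rightarrow> ereal) \<Rightarrow> (real^'n \<Rightarrow> real^'m) \<Rightarrow> (real^'n \<Rightarrow> ereal) \<Rightarrow> real^'n \<Rightarrow> ereal" where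
  "primal_obj f A h x = f (A x) + h x"

definition dual_obj ::
  "(real^'m \<Rightarrow> ereal) \<Rightarrow> (real^'n \<Rightarrow> real^'m) \<Rightarrow> (real^'n \<Rightarrow> ereal) \<Rightarrow> real^'m \<Rightarrow> ereal" where
  "dual_obj f A h y = conjugate f y + conjugate h (- adjoint A y)"

text \<open>The supremum is the maximum whenever the latter exists. It need not be attained or even finite
  for a closed convex function with compact domain.\<close>

definition variation_set :: "('a \<Rightarrow> ereal) \<Rightarrow> real set" where
  "variation_set h = {\<bar>fin h x - fin h x'\<bar> | x x'. x \<in> effdom h \<and> x' \<in> effdom h}"

definition variation :: "('a \<Rightarrow> ereal) \<Rightarrow> real" where
  "variation h = Sup (variation_set h)"

definition bregman :: "('a::real_inner \<Rightarrow> ereal) \<Rightarrow> 'a \<Rightarrow> 'a \<Rightarrow> ereal" where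
  "bregman w y y' = w y - w y' - ereal (grad w y' \<bullet> (y - y'))"

definition md_g ::
  "(real^'m \<Rightarrow> ereal) \<Rightarrow> (real^'n \<Rightarrow> real^'m) \<Rightarrow> real^'m \<Rightarrow> real^'n \<Rightarrow> real^'m" where
  "md_g f A y s = grad (conjugate f) y - A s"

definition md_G :: "(real^'m \<Rightarrow> ereal) \<Rightarrow> (real^'n \<Rightarrow> real^'m) \<Rightarrow> (real^'n \<Rightarrow> ereal) \<Rightarrow>
    real^'m \<Rightarrow> real^'n \<Rightarrow> real^'n \<Rightarrow> real" where
  "md_G f A h y z s = md_g f A y s \<bullet> y + fin h z - fin h s"

definition md_D ::
  "(real^'m \<Rightarrow> ereal) \<Rightarrow> (real^'n \<Rightarrow> real^'m) \<Rightarrow> real^'m \<Rightarrow> real^'n \<Rightarrow> real" where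
  "md_D f A y s = local_norm f (grad (conjugate f) y) (md_g f A y s)"

text \<open>For \<open>D = 0\<close> the quotient \<open>G / (D (G + D))\<close> is read as \<open>+\<infinity>\<close>, so the step-size is \<open>1\<close>
  (Isabelle's \<open>G / 0 = 0\<close> would give the step-size \<open>0\<close> instead).\<close>

definition md_step :: "real \<Rightarrow> real \<Rightarrow> real" where
  "md_step G D = (if D = 0 then 1 else min (G / (D * (G + D))) 1)"

definition md_gamma :: "(real^'m \<Rightarrow> ereal) \<Rightarrow> (real^'n \<Rightarrow> real^'m) \<Rightarrow> (real^'n \<Rightarrow> ereal) \<Rightarrow>
    real^'m \<Rightarrow> real^'n \<Rightarrow> real^'n \<Rightarrow> real" where
  "md_gamma f A h y z s = md_step (md_G f A h y z s) (md_D f A y s)"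

text \<open>
  The step-size can only vanish when \<open>md_G = 0\<close>, i.e. at a dual minimizer. Then \<open>inverse (ereal 0) = \<infinity>\<close>
  and \<open>\<infinity> * 0 = 0\<close>, so that the last conjunct says that the method stays at \<open>y k\<close>.
\<close>

definition mirror_descent :: "(real^'m) set \<Rightarrow> (real^'m \<Rightarrow> ereal) \<Rightarrow> (real^'n \<Rightarrow> real^'m) \<Rightarrow>
    (real^'n \<Rightarrow> ereal) \<Rightarrow> (nat \<Rightarrow> real^'m) \<Rightarrow> (nat \<Rightarrow> real^'n) \<Rightarrow> (nat \<Rightarrow> real^'n) \<Rightarrow> bool" where
  "mirror_descent K f A h y z s \<longleftrightarrow>
     y 0 \<in> interior (polar K) \<and>
     z 0 \<in> effdom h \<and> A (z 0) = grad (conjugate f) (y 0) \<and>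
     (\<forall>k. let g = md_g f A (y k) (s k); \<gamma> = md_gamma f A h (y k) (z k) (s k) in
        s k \<in> subdifferential (conjugate h) (- adjoint A (y k)) \<and>
        z (Suc k) = (1 - \<gamma>) *\<^sub>R z k + \<gamma> *\<^sub>R s k \<and>
        is_arg_min (\<lambda>v. ereal (g \<bullet> v) + inverse (ereal \<gamma>) * bregman (conjugate f) v (y k))
          (\<lambda>_. True) (y (Suc k)))"

text \<open>The number of iterations until the gap sequence \<open>d\<close> is at most \<open>\<epsilon>\<close>; it is \<open>\<infinity>\<close> if this
  never happens.\<close>

definition iterations_to :: "(nat \<Rightarrow> ereal) \<Rightarrow> real \<Rightarrow> enat" where
  "iterations_to d \<epsilon> = (INF k\<in>{k. d k \<le> ereal \<epsilon>}. enat k)"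

end

theory Submission
  imports Defs
begin

text \<open>
  Mirror descent on the dual objective \<open>d\<close> is the Frank-Wolfe method on the primal objective \<open>F\<close> in
  disguise. The conjugate \<open>f\<^sup>*\<close> is differentiable at every \<open>\<nabla>f(u)\<close>, with gradient \<open>u\<close>, and the
  minimizer in a mirror step is the point \<open>v\<close> with \<open>\<nabla>f\<^sup>*(v) = \<nabla>f\<^sup>*(y\<^sub>k) - \<gamma>\<^sub>k g\<^sub>k\<close>. Hence the link
  \<open>A z\<^sub>k \<in> interior K\<close>, \<open>y\<^sub>k = \<nabla>f(A z\<^sub>k)\<close> is preserved, and \<open>z\<^sub>k\<close> makes the Frank-Wolfe step towards \<open>s\<^sub>k\<close>.
  Since \<open>s\<^sub>k\<close> is a subgradient of \<open>h\<^sup>*\<close>, equality holds in the Fenchel-Young inequality, and so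
  \<open>G\<^sub>k = F(z\<^sub>k) + d(y\<^sub>k)\<close>. By weak duality, \<open>G\<^sub>k\<close> bounds both the primal gap \<open>\<delta>\<^sub>k\<close> and the dual gap \<open>d\<^sub>k\<close>.
  It is therefore enough to bound the number of iterations with \<open>G\<^sub>k > \<epsilon>\<close>, which is done by watching
  \<open>\<delta>\<^sub>k\<close> decrease.

  Self-concordance of \<open>f\<close> bounds \<open>f\<close> from above inside the Dikin ellipsoid. The step-size minimizes
  this bound, so \<open>\<delta>\<^sub>k\<close> decreases by at least \<open>\<omega>(G\<^sub>k / D\<^sub>k)\<close> with \<open>\<omega>(t) = t - ln (1 + t)\<close>, or by at
  least \<open>G\<^sub>k / 2\<close> if the full step is made. Logarithmic homogeneity gives \<open>D\<^sub>k \<le> G\<^sub>k + \<Theta>\<close> with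
  \<open>\<Theta> = \<theta> + R\<^sub>h\<close>. This leaves two regimes. An iteration with \<open>G\<^sub>k > \<Theta>\<close> is fast: it decreases \<open>\<delta>\<^sub>k\<close> by
  more than \<open>1/10.6\<close> and by more than the fraction \<open>1 / (5.3 (\<delta>\<^sub>0 + \<Theta>))\<close>, which yields the logarithmic
  term. An iteration with \<open>G\<^sub>k \<le> \<Theta>\<close> is slow: it decreases \<open>\<delta>\<^sub>k\<close> by at least \<open>(G\<^sub>k)\<^sup>2 / (12 \<Theta>\<^sup>2)\<close>. A concave
  potential of \<open>\<delta>\<^sub>k\<close> that never exceeds \<open>24 \<Theta>\<^sup>2 / \<epsilon>\<close> then drops by at least one, which yields the other
  term.

  If \<open>10.6 \<delta>\<^sub>0 < 1\<close>, then the logarithmic term is negative. In that case no iteration is fast, and the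
  estimate for the slow ones has enough slack: the first iteration gives
  \<open>\<epsilon>\<^sup>2 < (G\<^sub>0)\<^sup>2 \<le> 12 \<Theta>\<^sup>2 \<delta>\<^sub>0\<close>, so that a small \<open>\<delta>\<^sub>0\<close> forces a small \<open>\<epsilon>\<close>.
\<close>

section \<open>The function \<open>t - ln (1 + t)\<close> and the damped step\<close>

text \<open>The constant \<open>5.3\<close> of the iteration bound: \<open>1/5.3\<close> lies just below \<open>\<omega>(1/2) / (1/2) = 1 - 2 ln (3/2)\<close>,
  and \<open>1/10.6\<close> lies just below \<open>\<omega>(1/2)\<close>.\<close>

lemma ln_three_halves_less: "ln (3/2::real) < (1 - 1/5.3) / 2"
proof -
  \<comment> \<open>an eighth of the claimed bound; there the quadratic Taylor polynomial of \<open>exp\<close> is accurate enough\<close>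
  define x :: real where "x = (1 - 1/5.3) / 16"
  have "3/2 < (1 + x + x^2/2)^8"
    unfolding x_def by (simp add: power2_eq_square field_simps)
  also have "\<dots> \<le> exp x ^ 8"
    by (intro power_mono exp_lower_Taylor_quadratic) (auto simp: x_def)
  also have "\<dots> = exp (8 * x)"
    by (simp add: exp_of_nat_mult[symmetric])
  finally have "ln (3/2) < ln (exp (8*x))"
    by (subst ln_less_cancel_iff) auto
  then show ?thesis by (simp add: x_def)
qed

text \<open>Bounding the logarithm by its tangent at \<open>t = 1/2\<close> reduces the claim to the value there.\<close>

lemma omega_gt_linear:
  fixes t :: real
  assumes "t \<ge> 1/2"
  shows "t / 5.3 < t - ln (1 + t)"
proof -
  have "ln (1 + t) = ln (3/2) + ln ((1+t) / (3/2))"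
    using assms by (subst ln_mult_pos[symmetric]) auto
  also have "ln ((1+t) / (3/2)) \<le> (1+t) / (3/2) - 1"
    using assms by (intro ln_le_minus_one) auto
  finally show ?thesis using ln_three_halves_less assms by (simp add: field_simps)
qed

lemma omega_ge_quadratic:
  fixes t :: real
  assumes "0 \<le> t" "t \<le> 1/2"
  shows "t\<^sup>2 / 3 \<le> t - ln (1 + t)"
proof -
  let ?p = "\<lambda>t::real. t - ln (1 + t) - t\<^sup>2/3"
  have "?p 0 \<le> ?p t"
  proof (rule DERIV_nonneg_imp_nondecreasing[OF assms(1)])
    fix x :: real assume x: "0 \<le> x" "x \<le> t"
    have "(?p has_real_derivative (1 - 1/(1+x) - 2*x/3)) (at x)"
      using x by (auto intro!: derivative_eq_intros)
    moreover have "1 - 1/(1+x) - 2*x/3 = x * (1 - 2*x) / (3*(1+x))"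
      using x by (simp add: field_simps)
    moreover have "x * (1 - 2*x) / (3*(1+x)) \<ge> 0"
      using x assms by (intro divide_nonneg_nonneg mult_nonneg_nonneg) auto
    ultimately show "\<exists>y. (?p has_real_derivative y) (at x) \<and> 0 \<le> y" by metis
  qed
  then show ?thesis by simp
qed

lemma omega_mono:
  fixes s t :: real
  assumes "0 \<le> s" "s \<le> t"
  shows "s - ln (1 + s) \<le> t - ln (1 + t)"
proof -
  have "ln ((1+t)/(1+s)) \<le> (1+t)/(1+s) - 1"
    using assms by (intro ln_le_minus_one) auto
  also have "\<dots> = (t - s) / (1 + s)" using assms by (simp add: field_simps)
  also have "\<dots> \<le> t - s" using assms by (simp add: field_simps mult_left_mono)
  finally show ?thesis using assms by (simp add: ln_div)
qed

text \<open>With \<open>y = 1 / (1 - x)\<close> this is the inequality \<open>ln y \<le> (y - 1/y) / 2\<close> for \<open>y \<ge> 1\<close>.\<close>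

lemma omega_star_le:
  fixes x :: real
  assumes "0 \<le> x" "x < 1"
  shows "- x - ln (1 - x) \<le> x\<^sup>2 / (2 * (1 - x))"
proof -
  let ?p = "\<lambda>t::real. (inverse (1 - t) - (1 - t)) / 2 + ln (1 - t)"
  have "?p 0 \<le> ?p x"
  proof (rule DERIV_nonneg_imp_nondecreasing[OF assms(1)])
    fix t :: real assume t: "0 \<le> t" "t \<le> x"
    then have t1: "1 - t > 0" using assms by auto
    have "(?p has_real_derivative ((inverse (1 - t) - 1)\<^sup>2 / 2)) (at t)"
      by (rule derivative_eq_intros refl | use t1 in simp; fail)+
        (use t1 in \<open>simp add: power2_eq_square algebra_simps inverse_eq_divide\<close>)
    moreover have "(inverse (1 - t) - 1)\<^sup>2 / 2 \<ge> 0" by simp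
    ultimately show "\<exists>y. (?p has_real_derivative y) (at t) \<and> 0 \<le> y" by blast
  qed
  moreover have "(inverse (1 - x) - (1 - x)) / 2 = x + x\<^sup>2 / (2 * (1 - x))"
    using assms by (simp add: divide_simps) (simp add: power2_eq_square algebra_simps)
  ultimately show ?thesis by simp
qed

lemma damped_step_bounds:
  fixes G D :: real
  assumes G: "G > 0" and D: "D \<ge> 0"
  defines "\<gamma> \<equiv> md_step G D"
  shows "0 < \<gamma>" "\<gamma> \<le> 1" "\<gamma> * D < 1"
proof -
  show "0 < \<gamma>" "\<gamma> \<le> 1" using assms by (auto simp: \<gamma>_def md_step_def)
  show "\<gamma> * D < 1"
  proof (cases "D = 0")
    case False
    then have "\<gamma> * D \<le> G / (D * (G + D)) * D"
      using D unfolding \<gamma>_def md_step_def by (intro mult_right_mono) auto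
    also have "\<dots> = G / (G + D)" using False by simp
    also have "\<dots> < 1" using False G D by simp
    finally show ?thesis .
  qed simp
qed

text \<open>The quantity \<open>\<Delta>\<close> is the progress that self-concordance guarantees for the step-size \<open>\<gamma>\<close>. For \<open>\<gamma> < 1\<close>
  it equals \<open>\<omega>(G / D)\<close>, which is at least \<open>\<omega>(G / (G + \<Theta>))\<close>. A full step is made only if
  \<open>D\<^sup>2 / (1 - D) \<le> G\<close>, and then the progress is at least \<open>G / 2\<close>. The two regimes differ in whether the
  argument \<open>G / (G + \<Theta>)\<close> of \<open>\<omega>\<close> is above or below \<open>1/2\<close>.\<close>

lemma damped_step_decrease:
  fixes G D \<Theta> :: real
  assumes G: "G > 0" and D: "D \<ge> 0" and \<Theta>: "\<Theta> \<ge> 1" and DG: "D \<le> G + \<Theta>"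
  defines "\<gamma> \<equiv> md_step G D"
  defines "\<Delta> \<equiv> \<gamma> * G + \<gamma> * D + ln (1 - \<gamma> * D)"
  shows "G > \<Theta> \<Longrightarrow> G / (5.3 * (G + \<Theta>)) < \<Delta>"
    and "G \<le> \<Theta> \<Longrightarrow> G\<^sup>2 / (12 * \<Theta>\<^sup>2) \<le> \<Delta>"
proof -
  let ?t = "G / (G + \<Theta>)"
  have "\<Delta> \<ge> G / 2 \<or> \<Delta> \<ge> ?t - ln (1 + ?t)"
  proof (cases "D = 0 \<or> G / (D * (G + D)) \<ge> 1")
    case True
    then have \<gamma>: "\<gamma> = 1" by (auto simp: \<gamma>_def md_step_def)
    then have D1: "D < 1" using damped_step_bounds(3)[OF G D] by (simp add: \<gamma>_def)
    \<comment> \<open>\<open>X / 2\<close> bounds the loss \<open>- D - ln (1 - D)\<close> of a full step.\<close>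
    define X where "X = D\<^sup>2 / (1 - D)"
    have "D\<^sup>2 / (1 - D) \<le> G"
    proof (cases "D = 0")
      case False
      then have "D * (G + D) > 0" "1 \<le> G / (D * (G + D))" using True D G by auto
      then have "D * (G + D) \<le> G" by (simp add: le_divide_eq)
      then show ?thesis using D1 by (simp add: field_simps power2_eq_square)
    qed (use G in auto)
    then have "X \<le> G" by (simp add: X_def)
    moreover have "- D - ln (1 - D) \<le> X / 2" unfolding X_def
      using omega_star_le[OF D D1] by (metis divide_divide_eq_left mult.commute)
    ultimately have "G / 2 \<le> G + D + ln (1 - D)" by linarith
    then have "G / 2 \<le> \<Delta>" by (simp only: \<Delta>_def \<gamma> mult_1)
    then show ?thesis ..
  next
    case False
    then have D0: "D > 0" and \<gamma>: "\<gamma> = G / (D * (G + D))" using D by (auto simp: \<gamma>_def md_step_def)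
    have \<gamma>D: "\<gamma> * D = G / (G + D)" using D0 by (simp add: \<gamma>)
    have "1 - \<gamma> * D = inverse (1 + G / D)" unfolding \<gamma>D using D0 G by (simp add: field_simps)
    then have "ln (1 - \<gamma> * D) = - ln (1 + G / D)" using D0 G by (simp add: ln_inverse add_pos_pos)
    moreover have "\<gamma> * G + \<gamma> * D = G / D"
      unfolding \<gamma>D unfolding \<gamma> using D0 G by (simp add: divide_simps) (simp add: algebra_simps)
    ultimately have "\<Delta> = G / D - ln (1 + G / D)" by (simp add: \<Delta>_def)
    moreover have "?t \<le> G / D" using D0 G DG by (intro divide_left_mono) auto
    ultimately show ?thesis using omega_mono[of ?t "G / D"] G \<Theta> by auto
  qed
  note cases = this
  have t: "5.3 * (G + \<Theta>) > 2" using G \<Theta> by simp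
  show "G / (5.3 * (G + \<Theta>)) < \<Delta>" if "G > \<Theta>"
    using cases
  proof
    assume "G / 2 \<le> \<Delta>"
    moreover have "G / (5.3 * (G + \<Theta>)) < G / 2" using t G by (intro divide_strict_left_mono) auto
    ultimately show ?thesis by simp
  next
    assume "?t - ln (1 + ?t) \<le> \<Delta>"
    have half: "1/2 \<le> ?t" using that G \<Theta> by (simp add: field_simps)
    have "G / (5.3 * (G + \<Theta>)) = ?t / 5.3" by (metis divide_divide_eq_left mult.commute)
    also have "\<dots> < ?t - ln (1 + ?t)" by (rule omega_gt_linear[OF half])
    also have "\<dots> \<le> \<Delta>" by fact
    finally show ?thesis .
  qed
  show "G\<^sup>2 / (12 * \<Theta>\<^sup>2) \<le> \<Delta>" if "G \<le> \<Theta>"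
    using cases
  proof
    assume *: "G / 2 \<le> \<Delta>"
    have "G * G \<le> \<Theta> * G" using that G by (intro mult_right_mono) auto
    also have "\<dots> \<le> \<Theta> * G * (6 * \<Theta>)" using G \<Theta> by simp
    finally have "G * G / (12 * \<Theta> * \<Theta>) \<le> G / 2" using \<Theta> by (simp add: field_simps)
    then show ?thesis using * by (simp add: power2_eq_square mult.assoc)
  next
    assume *: "?t - ln (1 + ?t) \<le> \<Delta>"
    have "G / (2 * \<Theta>) \<le> ?t" using that G \<Theta> by (intro divide_left_mono) auto
    then have "(G / (2 * \<Theta>))\<^sup>2 \<le> ?t\<^sup>2" using G \<Theta> by (intro power_mono) auto
    moreover have "?t\<^sup>2 / 3 \<le> ?t - ln (1 + ?t)"
      using that G \<Theta> by (intro omega_ge_quadratic) (auto simp: field_simps)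
    ultimately show ?thesis using * by (simp add: power_divide power_mult_distrib)
  qed
qed

section \<open>Counting iterations\<close>

text \<open>An antiderivative of \<open>M / (max x \<epsilon>)\<^sup>2\<close>, namely the time which the flow \<open>x' = - (max x \<epsilon>)\<^sup>2 / M\<close> needs
  to bring \<open>x\<close> down to \<open>0\<close>. It is concave because its derivative is nonincreasing, so a decrease of \<open>x\<close>
  by \<open>(max x \<epsilon>)\<^sup>2 / M\<close> lowers it by at least one.\<close>

definition slow_potential :: "real \<Rightarrow> real \<Rightarrow> real \<Rightarrow> real" where
  "slow_potential M \<epsilon> x = (if \<epsilon> \<le> x then M * (2 / \<epsilon> - 1 / x) else M * x / \<epsilon>\<^sup>2)"

lemma slow_potential_nonneg:
  assumes "M \<ge> 0" "\<epsilon> > 0" "x \<ge> 0"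
  shows "slow_potential M \<epsilon> x \<ge> 0"
proof -
  have "1 / x \<le> 2 / \<epsilon>" if "\<epsilon> \<le> x" using that assms by (simp add: field_simps)
  then show ?thesis using assms by (auto simp: slow_potential_def)
qed

lemma slow_potential_le:
  assumes "M \<ge> 0" "\<epsilon> > 0" "x \<ge> 0"
  shows "slow_potential M \<epsilon> x \<le> 2 * M / \<epsilon>"
proof (cases "\<epsilon> \<le> x")
  case True
  then have "M * (2 / \<epsilon> - 1 / x) \<le> M * (2 / \<epsilon>)" using assms by (intro mult_left_mono) auto
  then show ?thesis using True by (simp add: slow_potential_def mult.commute)
next
  case False
  then have "M * x / \<epsilon>\<^sup>2 \<le> M * \<epsilon> / \<epsilon>\<^sup>2" using assms by (intro divide_right_mono mult_left_mono) auto
  also have "\<dots> = M / \<epsilon>" using assms by (simp add: power2_eq_square)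
  also have "\<dots> \<le> 2 * M / \<epsilon>" using assms by (simp add: divide_right_mono)
  finally show ?thesis using False by (simp add: slow_potential_def)
qed

lemma slow_potential_tangent:
  assumes M: "M \<ge> 0" and \<epsilon>: "\<epsilon> > 0" and x': "0 \<le> x'" "x' \<le> x"
  shows "slow_potential M \<epsilon> x' + M * (x - x') / (max x \<epsilon>)\<^sup>2 \<le> slow_potential M \<epsilon> x"
proof -
  consider "x < \<epsilon>" | "\<epsilon> \<le> x'" | "x' < \<epsilon>" "\<epsilon> \<le> x" using x' by linarith
  then show ?thesis
  proof cases
    case 1
    then have "max x \<epsilon> = \<epsilon>" "\<not> \<epsilon> \<le> x'" using x' by auto
    with 1 show ?thesis using x' by (simp add: slow_potential_def add_divide_distrib[symmetric] algebra_simps)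
  next
    case 2
    then have p: "x' > 0" "x > 0" and m: "max x \<epsilon> = x" using x' \<epsilon> by auto
    have "(x - x') / x\<^sup>2 \<le> (x - x') / (x * x')"
      using p x' by (intro divide_left_mono) (auto simp: power2_eq_square)
    also have "\<dots> = 1 / x' - 1 / x" using p by (simp add: field_simps)
    finally have "M * ((x - x') / x\<^sup>2) \<le> M * (1 / x' - 1 / x)" using M by (rule mult_left_mono)
    then show ?thesis using 2 x' m by (simp add: slow_potential_def algebra_simps)
  next
    case 3
    then have p: "x > 0" and m: "max x \<epsilon> = x" using \<epsilon> by auto
    have "x' / \<epsilon> \<le> 1" "x' / x \<le> 1" using 3 x' \<epsilon> p by auto
    then have "0 \<le> 2 - x' * (1 / \<epsilon> + 1 / x)" by (simp add: algebra_simps)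
    moreover have "1 / \<epsilon> - 1 / x \<ge> 0" using 3 \<epsilon> by (simp add: field_simps)
    ultimately have "0 \<le> M * ((1 / \<epsilon> - 1 / x) * (2 - x' * (1 / \<epsilon> + 1 / x)))" using M by simp
    also have "(1 / \<epsilon> - 1 / x) * (2 - x' * (1 / \<epsilon> + 1 / x)) = 2 / \<epsilon> - 1 / x - x' / \<epsilon>\<^sup>2 - (x - x') / x\<^sup>2"
      using p \<epsilon> by (simp add: field_simps power2_eq_square)
    finally show ?thesis using 3 m by (simp add: slow_potential_def algebra_simps)
  qed
qed

text \<open>The numerical core: \<open>\<delta>\<close> is a nonnegative sequence that decreases at the rates of the fast and the slow
  regime as long as \<open>G\<close> exceeds \<open>\<epsilon>\<close>. After \<open>q\<close> fast iterations \<open>\<delta>\<close> is at most \<open>\<delta>\<^sub>0 exp (- q / c)\<close> with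
  \<open>c = 5.3 (\<delta>\<^sub>0 + \<Theta>)\<close>, but \<open>\<delta>\<close> exceeds \<open>1/10.6\<close> whenever another one is made. The slow iterations are paid
  for by the potential.\<close>

lemma iteration_count:
  fixes \<delta> G :: "nat \<Rightarrow> real"
  assumes \<Theta>: "\<Theta> \<ge> 1" and \<epsilon>: "\<epsilon> > 0" and n: "n > 0"
    and nonneg: "\<And>k. k \<le> n \<Longrightarrow> 0 \<le> \<delta> k"
    and gap: "\<And>k. k < n \<Longrightarrow> \<delta> k \<le> G k" "\<And>k. k < n \<Longrightarrow> \<epsilon> < G k"
    and fast: "\<And>k. k < n \<Longrightarrow> \<Theta> < G k \<Longrightarrow> \<delta> (Suc k) < \<delta> k - G k / (5.3 * (G k + \<Theta>))"
    and slow: "\<And>k. k < n \<Longrightarrow> G k \<le> \<Theta> \<Longrightarrow> \<delta> (Suc k) \<le> \<delta> k - (G k)\<^sup>2 / (12 * \<Theta>\<^sup>2)"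
  shows "int n \<le> \<lceil>5.3 * (\<delta> 0 + \<Theta>) * ln (10.6 * \<delta> 0)\<rceil> + \<lceil>24 * \<Theta>\<^sup>2 / \<epsilon>\<rceil>"
proof -
  define c where "c = 5.3 * (\<delta> 0 + \<Theta>)"
  define M where "M = 12 * \<Theta>\<^sup>2"
  define Q where "Q k = card {j. j < k \<and> \<Theta> < G j}" for k
  define T where "T = slow_potential M \<epsilon>"
  have \<delta>0: "\<delta> 0 \<ge> 0" using nonneg[of 0] by simp
  have c: "c > 5" using \<Theta> \<delta>0 by (simp add: c_def)
  have M: "M > 0" using \<Theta> by (simp add: M_def)
  have Q0: "Q 0 = 0" by (simp add: Q_def)
  have QS: "Q (Suc k) = (if \<Theta> < G k then Suc (Q k) else Q k)" for k
  proof -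
    have "{j. j < Suc k \<and> \<Theta> < G j} =
      (if \<Theta> < G k then insert k {j. j < k \<and> \<Theta> < G j} else {j. j < k \<and> \<Theta> < G j})"
      by (auto simp: less_Suc_eq)
    then show ?thesis by (simp add: Q_def)
  qed
  have G0: "0 < G k" if "k < n" for k using gap(2)[OF that] \<epsilon> by simp
  have mono: "\<delta> (Suc k) \<le> \<delta> k" if "k < n" for k
  proof (cases "\<Theta> < G k")
    case True
    moreover have "G k / (5.3 * (G k + \<Theta>)) \<ge> 0" using True \<Theta> by simp
    ultimately show ?thesis using fast[OF that] by linarith
  next
    case False
    moreover have "(G k)\<^sup>2 / (12 * \<Theta>\<^sup>2) \<ge> 0" by simp
    ultimately show ?thesis using slow[OF that] by linarith
  qed
  have le0: "\<delta> k \<le> \<delta> 0" if "k \<le> n" for k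
    using that by (induction k) (auto intro: order_trans[OF mono])
  have fast_large: "1 / 10.6 < \<delta> k" if k: "k < n" "\<Theta> < G k" for k
  proof -
    have "1 / 10.6 \<le> G k / (5.3 * (G k + \<Theta>))" using k \<Theta> by (simp add: field_simps)
    then show ?thesis using fast[OF k] nonneg[of "Suc k"] k by linarith
  qed
  have geo: "\<delta> k \<le> \<delta> 0 * (1 - 1 / c) ^ Q k" if "k \<le> n" for k
    using that
  proof (induction k)
    case (Suc k)
    then have k: "k < n" and IH: "\<delta> k \<le> \<delta> 0 * (1 - 1 / c) ^ Q k" by auto
    show ?case
    proof (cases "\<Theta> < G k")
      case True
      have "\<delta> k / c \<le> \<delta> k / (5.3 * (\<delta> k + \<Theta>))"
        using nonneg[of k] le0[of k] k \<Theta> c unfolding c_def by (intro divide_left_mono) auto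
      also have "\<dots> \<le> G k / (5.3 * (G k + \<Theta>))"
        using nonneg[of k] gap(1)[OF k] k \<Theta>
        by (simp add: divide_simps) (auto simp: algebra_simps)
      finally have "\<delta> (Suc k) \<le> \<delta> k * (1 - 1 / c)"
        using fast[OF k True] by (simp add: algebra_simps)
      also have "\<dots> \<le> \<delta> 0 * (1 - 1 / c) ^ Q k * (1 - 1 / c)"
        using IH c by (intro mult_right_mono) auto
      finally show ?thesis using True by (simp add: QS mult_ac)
    next
      case False
      then show ?thesis using mono[OF k] IH by (simp add: QS)
    qed
  qed (simp add: Q0)
  have fast_count: "real (Q k) < 1 + c * ln (10.6 * \<delta> 0)" if "k \<le> n" "Q k > 0" for k
    using that
  proof (induction k)
    case (Suc k)
    then have k: "k < n" by simp
    show ?case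
    proof (cases "\<Theta> < G k")
      case True
      have "1 / 10.6 < \<delta> k" by (rule fast_large[OF k True])
      also have "\<dots> \<le> \<delta> 0 * (1 - 1 / c) ^ Q k" using geo k by simp
      also have "\<dots> \<le> \<delta> 0 * exp (- (1 / c)) ^ Q k"
        using \<delta>0 c exp_ge_add_one_self[of "- (1 / c)"] by (intro mult_left_mono power_mono) auto
      also have "exp (- (1 / c)) ^ Q k = exp (- (Q k / c))"
        by (simp add: exp_of_nat_mult[symmetric])
      finally have *: "exp (Q k / c) < 10.6 * \<delta> 0" by (simp add: exp_minus field_simps)
      moreover have "0 < 10.6 * \<delta> 0" using * exp_gt_zero[of "Q k / c"] by linarith
      ultimately have "Q k / c < ln (10.6 * \<delta> 0)" by (metis exp_less_cancel_iff exp_ln)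
      then show ?thesis using True c by (simp add: QS field_simps)
    next
      case False
      then show ?thesis using Suc by (simp add: QS)
    qed
  qed (simp add: Q0)
  have slow_count: "T (\<delta> k) + real (k - Q k) \<le> T (\<delta> 0) \<and> Q k \<le> k" if "k \<le> n" for k
    using that
  proof (induction k)
    case (Suc k)
    then have k: "k < n" and IH: "T (\<delta> k) + real (k - Q k) \<le> T (\<delta> 0)" "Q k \<le> k" by auto
    have "T (\<delta> (Suc k)) + M * (\<delta> k - \<delta> (Suc k)) / (max (\<delta> k) \<epsilon>)\<^sup>2 \<le> T (\<delta> k)"
      unfolding T_def using M \<epsilon> nonneg[of "Suc k"] k mono[OF k] by (intro slow_potential_tangent) auto
    moreover have "0 \<le> M * (\<delta> k - \<delta> (Suc k)) / (max (\<delta> k) \<epsilon>)\<^sup>2" using M mono[OF k] by simp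
    moreover have "1 \<le> M * (\<delta> k - \<delta> (Suc k)) / (max (\<delta> k) \<epsilon>)\<^sup>2" if "G k \<le> \<Theta>"
    proof -
      have "(max (\<delta> k) \<epsilon>)\<^sup>2 \<le> (G k)\<^sup>2" using gap[OF k] \<epsilon> by (intro power_mono) auto
      also have "\<dots> \<le> M * (\<delta> k - \<delta> (Suc k))"
        using slow[OF k that] M by (simp add: M_def field_simps)
      finally show ?thesis using \<epsilon> by (simp add: max_def)
    qed
    ultimately show ?case using IH by (auto simp: QS Suc_diff_le not_less)
  qed (simp add: Q0)
  have Tn: "0 \<le> T (\<delta> n)" unfolding T_def using M \<epsilon> nonneg[of n] by (intro slow_potential_nonneg) auto
  then have slow_n: "real (n - Q n) \<le> T (\<delta> 0)" "Q n \<le> n" using slow_count[of n] by auto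
  show ?thesis
  proof (cases "1 \<le> 10.6 * \<delta> 0")
    case True
    have "int (Q n) \<le> \<lceil>c * ln (10.6 * \<delta> 0)\<rceil>"
    proof (cases "Q n = 0")
      case True
      moreover have "0 \<le> c * ln (10.6 * \<delta> 0)" using c \<open>1 \<le> 10.6 * \<delta> 0\<close> by simp
      ultimately show ?thesis by (simp; linarith)
    next
      case False
      then show ?thesis using fast_count[of n] by linarith
    qed
    moreover have "T (\<delta> 0) \<le> 2 * M / \<epsilon>" unfolding T_def using M \<epsilon> \<delta>0 by (intro slow_potential_le) auto
    then have "int (n - Q n) \<le> \<lceil>24 * \<Theta>\<^sup>2 / \<epsilon>\<rceil>" using slow_n(1) by (simp add: M_def) linarith
    ultimately show ?thesis using slow_n(2) by (simp add: c_def)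
  next
    case False
    have "Q n = 0"
    proof -
      have "\<not> \<Theta> < G k" if "k < n" for k using fast_large[OF that] le0[of k] that False by auto
      then show ?thesis by (simp add: Q_def)
    qed
    then have nT: "real n \<le> T (\<delta> 0)" using slow_n by simp
    have "\<not> \<Theta> < G 0" using fast_large[OF n] False by auto
    then have G0M: "(G 0)\<^sup>2 \<le> M * \<delta> 0"
    proof -
      have "(G 0)\<^sup>2 + M * \<delta> 1 \<le> M * \<delta> 0"
        using slow[OF n] \<open>\<not> \<Theta> < G 0\<close> M by (simp add: M_def field_simps)
      moreover have "0 \<le> M * \<delta> 1" using M nonneg[of 1] n by simp
      ultimately show ?thesis by linarith
    qed
    have "\<epsilon>\<^sup>2 \<le> (G 0)\<^sup>2" using gap(2)[OF n] \<epsilon> by (intro power_mono) auto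
    then have \<epsilon>M: "\<epsilon>\<^sup>2 \<le> M * \<delta> 0" using G0M by simp
    then have \<delta>pos: "\<delta> 0 > 0" using \<epsilon> M by (smt (verit) mult_nonneg_nonpos zero_less_power)
    define L where "L = - ln (10.6 * \<delta> 0)"
    have cb: "c \<le> 5.83 * \<Theta>" using False \<Theta> by (simp add: c_def)
    have L0: "L \<ge> 0" using False \<delta>pos by (simp add: L_def)
    \<comment> \<open>The slack between the potential and its bound \<open>2 M / \<epsilon>\<close> pays for the negative logarithmic term.\<close>
    have "T (\<delta> 0) + c * L \<le> 24 * \<Theta>\<^sup>2 / \<epsilon>"
    proof (cases "\<epsilon> \<le> \<delta> 0")
      case True
      have "L = ln (1 / (10.6 * \<delta> 0))" using \<delta>pos by (simp add: L_def ln_div)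
      also have "\<dots> \<le> 1 / (10.6 * \<delta> 0)" using \<delta>pos ln_le_minus_one[of "1 / (10.6 * \<delta> 0)"] by simp
      finally have "c * L \<le> 5.83 * \<Theta> * (1 / (10.6 * \<delta> 0))" using cb L0 c by (intro mult_mono) auto
      also have "\<dots> \<le> \<Theta> / \<delta> 0" using \<delta>pos \<Theta> by (simp add: field_simps)
      also have "\<dots> \<le> M / \<delta> 0" using \<delta>pos \<Theta> unfolding M_def
        by (intro divide_right_mono) (auto simp: power2_eq_square)
      finally show ?thesis using True \<epsilon> by (simp add: T_def slow_potential_def M_def algebra_simps)
    next
      case False
      \<comment> \<open>\<open>L = 2 ln (1 / r)\<close> is at most \<open>1 / r\<close>, and \<open>\<epsilon>\<^sup>2 \<le> M \<delta>\<^sub>0\<close> bounds \<open>\<epsilon>\<close> by a multiple of \<open>r\<close>.\<close>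
      define r where "r = sqrt (10.6 * \<delta> 0)"
      have r: "r > 0" using \<delta>pos by (simp add: r_def)
      have rr: "r * r = 10.6 * \<delta> 0" using \<delta>pos by (simp add: r_def)
      have "\<epsilon> \<le> sqrt (M * \<delta> 0)" using \<epsilon>M \<epsilon> by (simp add: real_le_rsqrt)
      also have "M * \<delta> 0 \<le> (1.1 * \<Theta> * r)\<^sup>2"
        using rr \<delta>pos \<Theta> by (simp add: M_def power2_eq_square field_simps)
      then have "sqrt (M * \<delta> 0) \<le> 1.1 * \<Theta> * r" using r \<Theta> by (intro real_le_lsqrt) auto
      finally have \<epsilon>r: "\<epsilon> \<le> 1.1 * \<Theta> * r" .
      have "L = 2 * ln (1 / r)"
      proof -
        have "L = - ln (r * r)" by (simp add: L_def rr)
        also have "\<dots> = 2 * ln (1 / r)" using r by (simp add: ln_mult ln_div)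
        finally show ?thesis .
      qed
      \<comment> \<open>Splitting off \<open>ln 2 < 1\<close> improves \<open>ln x \<le> x - 1\<close> to \<open>ln x \<le> x / 2\<close>.\<close>
      also have "ln (1 / r) = ln 2 + ln (1 / (2 * r))" using r by (simp add: ln_mult ln_div)
      also have "ln (1 / (2 * r)) \<le> 1 / (2 * r) - 1" using r by (intro ln_le_minus_one) auto
      finally have "L \<le> 1 / r" using ln_2_less_1 by simp
      then have "c * L \<le> 5.83 * \<Theta> * (1 / r)" using cb L0 c by (intro mult_mono) auto
      also have "\<dots> \<le> M / (1.1 * \<Theta> * r)"
        using r \<Theta> by (simp add: M_def field_simps power2_eq_square)
      also have "\<dots> \<le> M / \<epsilon>" using \<epsilon>r \<epsilon> M r \<Theta> by (intro divide_left_mono) auto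
      finally have "c * L \<le> M / \<epsilon>" .
      moreover have "M * \<delta> 0 / \<epsilon>\<^sup>2 \<le> M * \<epsilon> / \<epsilon>\<^sup>2"
        using False M by (intro divide_right_mono mult_left_mono) auto
      ultimately show ?thesis using False \<epsilon>
        by (simp add: T_def slow_potential_def M_def power2_eq_square)
    qed
    then have "real n \<le> c * ln (10.6 * \<delta> 0) + 24 * \<Theta>\<^sup>2 / \<epsilon>" using nT by (simp add: L_def)
    then show ?thesis unfolding c_def by linarith
  qed
qed

section \<open>Gradients and Fenchel conjugates\<close>

lemma GDERIV_unique:
  assumes "GDERIV g u :> a" "GDERIV g u :> b"
  shows "a = b"
proof -
  have "(\<lambda>w. w \<bullet> a) = (\<lambda>w. w \<bullet> b)"
    using assms unfolding gderiv_def by (rule has_derivative_unique)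
  then have "(a - b) \<bullet> a = (a - b) \<bullet> b" by meson
  then have "(a - b) \<bullet> (a - b) = 0" by (simp add: inner_diff_right)
  then show ?thesis by simp
qed

lemma grad_eqI: "GDERIV (fin w) u :> D \<Longrightarrow> grad w u = D"
  unfolding grad_def by (rule the_equality) (auto intro: GDERIV_unique)

lemma differentiable_imp_GDERIV:
  fixes g :: "'a::euclidean_space \<Rightarrow> real"
  assumes "g differentiable (at u)"
  shows "\<exists>D. GDERIV g u :> D"
proof -
  obtain g' where g': "(g has_derivative g') (at u)" using assms by (auto simp: differentiable_def)
  have "g' = (\<lambda>w. w \<bullet> adjoint g' 1)"
    using adjoint_works[OF has_derivative_linear[OF g'], of _ 1] by auto
  then show ?thesis using g' unfolding gderiv_def by metis
qed

lemma fenchel_young: "ereal (g \<bullet> u) - w u \<le> conjugate w g"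
  unfolding conjugate_def by (rule SUP_upper) simp

text \<open>This is the part of the Fenchel-Moreau theorem that turns a subgradient \<open>s\<close> of \<open>h\<^sup>*\<close> at \<open>q\<close> into
  equality in the Fenchel-Young inequality. If \<open>h(s)\<close> exceeded \<open>\<langle>s, q\<rangle> - h\<^sup>*(q)\<close>, a hyperplane would separate
  \<open>(s, \<langle>s, q\<rangle> - h\<^sup>*(q))\<close> from the epigraph of \<open>h\<close>. A non-vertical one shows that \<open>h\<^sup>*\<close> violates the
  subgradient inequality at its slope, a vertical one that it does so at \<open>q - p\<close>, where \<open>p\<close> is its normal.\<close>

lemma fenchel_equality_of_conjugate_subgradient:
  fixes h :: "'a::euclidean_space \<Rightarrow> ereal"
  assumes h: "proper_closed_convex h" and s: "s \<in> subdifferential (conjugate h) q"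
  shows "s \<in> effdom h" "conjugate h q = ereal (q \<bullet> s - fin h s)"
proof -
  have not_MInf: "h x \<noteq> - \<infinity>" for x using h by (auto simp: proper_closed_convex_def)
  obtain c where c: "conjugate h q = ereal c"
    using s by (cases "conjugate h q") (auto simp: subdifferential_def)
  have sub: "ereal (c + s \<bullet> (v - q)) \<le> conjugate h v" for v
    using s c by (auto simp: subdifferential_def)
  define \<alpha> where "\<alpha> = s \<bullet> q - c"
  have "(s, \<alpha>) \<in> epi h"
  proof (rule ccontr)
    assume "(s, \<alpha>) \<notin> epi h"
    moreover have "convex (epi h)" "closed (epi h)" using h by (auto simp: proper_closed_convex_def)
    ultimately obtain a b where ab: "a \<bullet> (s, \<alpha>) < b" "\<And>x. x \<in> epi h \<Longrightarrow> b < a \<bullet> x"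
      using separating_hyperplane_closed_point by metis
    obtain p \<beta> where a: "a = (p, \<beta>)" by (cases a)
    have below: "p \<bullet> s + \<beta> * \<alpha> < b" using ab(1) by (simp add: a inner_prod_def)
    have above: "b < p \<bullet> x + \<beta> * t" if "h x \<le> ereal t" for x t
      using ab(2)[of "(x, t)"] that by (simp add: a inner_prod_def epi_def)
    obtain x0 where "h x0 < \<infinity>" using h by (auto simp: proper_closed_convex_def effdom_def)
    then obtain t0 where t0: "h x0 = ereal t0" using not_MInf[of x0] by (cases "h x0") auto
    have \<beta>: "0 \<le> \<beta>"
    proof (rule ccontr)
      assume "\<not> 0 \<le> \<beta>"
      then have neg: "\<beta> < 0" by simp
      define t where "t = max t0 ((b - p \<bullet> x0) / \<beta>)"
      have "(b - p \<bullet> x0) / \<beta> \<le> t" by (simp add: t_def)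
      then have "\<beta> * t \<le> b - p \<bullet> x0" using neg by (simp add: field_simps)
      moreover have "b < p \<bullet> x0 + \<beta> * t" by (rule above) (simp add: t0 t_def)
      ultimately show False by simp
    qed
    have conj_le: "conjugate h v \<le> ereal r" if "\<And>x t. h x = ereal t \<Longrightarrow> v \<bullet> x - t \<le> r" for v r
      unfolding conjugate_def
    proof (rule SUP_least)
      fix x show "ereal (v \<bullet> x) - h x \<le> ereal r"
        using that[of x] not_MInf[of x] by (cases "h x") auto
    qed
    show False
    proof (cases "\<beta> = 0")
      case False
      then have \<beta>: "0 < \<beta>" using \<beta> by simp
      \<comment> \<open>the slope of the hyperplane, seen as an affine minorant of \<open>h\<close>\<close>
      let ?v = "- (1 / \<beta>) *\<^sub>R p"
      have "conjugate h ?v \<le> ereal (- b / \<beta>)"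
      proof (rule conj_le)
        fix x t assume "h x = ereal t"
        then have "b < p \<bullet> x + \<beta> * t" by (intro above) simp
        then have "b / \<beta> < (p \<bullet> x + \<beta> * t) / \<beta>" using \<beta> by (rule divide_strict_right_mono)
        then show "?v \<bullet> x - t \<le> - b / \<beta>" using \<beta> by (simp add: add_divide_distrib)
      qed
      then have "ereal (c + s \<bullet> (?v - q)) \<le> ereal (- b / \<beta>)" using sub order_trans by blast
      then have "c - (p \<bullet> s) / \<beta> - s \<bullet> q \<le> - b / \<beta>" by (simp add: inner_diff_right inner_commute)
      from mult_left_mono[OF this, of \<beta>] have "\<beta> * c - p \<bullet> s - \<beta> * (s \<bullet> q) \<le> - b"
        using \<beta> by (simp add: right_diff_distrib)
      then show False using below by (simp add: \<alpha>_def right_diff_distrib)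
    next
      case True
      let ?v = "q - p"
      have "conjugate h ?v \<le> ereal (c - b)"
      proof (rule conj_le)
        fix x t assume t: "h x = ereal t"
        then have "b < p \<bullet> x" using above[of x t] True by simp
        moreover have "q \<bullet> x - t \<le> c" using fenchel_young[of q x h] by (simp add: t c)
        ultimately show "?v \<bullet> x - t \<le> c - b" by (simp add: inner_diff_left)
      qed
      then have "ereal (c + s \<bullet> (?v - q)) \<le> ereal (c - b)" using sub order_trans by blast
      then show False using below True by (simp add: inner_commute)
    qed
  qed
  then have le: "h s \<le> ereal \<alpha>" by (simp add: epi_def)
  then show "s \<in> effdom h" by (auto simp: effdom_def)
  obtain t where t: "h s = ereal t" using le not_MInf[of s] by (cases "h s") auto
  have "q \<bullet> s - t \<le> c" using fenchel_young[of q s h] by (simp add: t c)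
  then show "conjugate h q = ereal (q \<bullet> s - fin h s)"
    using le by (simp add: t c \<alpha>_def inner_commute)
qed

section \<open>Self-concordant functions of one variable\<close>

text \<open>The differential inequality \<open>\<bar>p'\<bar> \<le> 2 p\<^sup>3\<^sup>/\<^sup>2\<close> says that \<open>1 / \<surd>p\<close> has Lipschitz constant one. The shift by
  \<open>\<eta> > 0\<close> keeps this meaningful where \<open>p\<close> vanishes, since the inequality for \<open>p\<close> implies the one for \<open>p + \<eta>\<close>.\<close>

lemma self_concordant_inverse_sqrt:
  fixes p p' :: "real \<Rightarrow> real"
  assumes t: "0 \<le> t" and \<eta>: "0 < \<eta>"
    and deriv: "\<And>x. 0 \<le> x \<Longrightarrow> x \<le> t \<Longrightarrow> (p has_real_derivative p' x) (at x)"
    and nonneg: "\<And>x. 0 \<le> x \<Longrightarrow> x \<le> t \<Longrightarrow> 0 \<le> p x"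
    and sc: "\<And>x. 0 \<le> x \<Longrightarrow> x \<le> t \<Longrightarrow> \<bar>p' x\<bar> \<le> 2 * p x powr (3/2)"
  shows "\<bar>(p t + \<eta>) powr (-1/2) - (p 0 + \<eta>) powr (-1/2)\<bar> \<le> t"
proof -
  let ?\<psi> = "\<lambda>x. (p x + \<eta>) powr (-1/2)"
  let ?\<psi>' = "\<lambda>x. (-1/2) * (p x + \<eta>) powr (-3/2) * p' x"
  have "norm (?\<psi> t - ?\<psi> 0) \<le> 1 * norm (t - 0)"
  proof (rule field_differentiable_bound[where S = "{0..t}" and f' = ?\<psi>'])
    fix x assume x: "x \<in> {0..t}"
    then have pos: "0 < p x + \<eta>" using nonneg[of x] \<eta> by auto
    have "(?\<psi> has_real_derivative ?\<psi>' x) (at x)"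
      by (rule derivative_eq_intros deriv refl | use x pos in simp; fail)+
    then show "(?\<psi> has_real_derivative ?\<psi>' x) (at x within {0..t})" by (rule has_field_derivative_at_within)
    have "\<bar>p' x\<bar> \<le> 2 * p x powr (3/2)" using sc x by auto
    also have "\<dots> \<le> 2 * (p x + \<eta>) powr (3/2)"
      using nonneg[of x] x \<eta> by (intro mult_left_mono powr_mono2) auto
    finally have "(1/2) * (p x + \<eta>) powr (-3/2) * \<bar>p' x\<bar>
      \<le> (1/2) * (p x + \<eta>) powr (-3/2) * (2 * (p x + \<eta>) powr (3/2))" by (intro mult_left_mono) auto
    also have "\<dots> = (p x + \<eta>) powr (-3/2 + 3/2)" unfolding powr_add by simp
    also have "\<dots> = 1" using pos by simp
    finally show "norm (?\<psi>' x) \<le> 1" by (simp add: abs_mult)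
  qed (use t in auto)
  then show ?thesis using t by simp
qed

lemma powr_minus_half: "x > 0 \<Longrightarrow> x powr (-1/2) = 1 / sqrt x" for x :: real
  by (simp add: powr_minus_divide powr_half_sqrt)

text \<open>The preceding lemma for the shift \<open>\<eta> = a\<^sup>2 - p 0\<close>, which makes \<open>1 / a\<close> the initial value of the
  inverse square root.\<close>

lemma self_concordant_second_derivative_bounds:
  fixes p p' :: "real \<Rightarrow> real"
  assumes t: "0 \<le> t" and a: "0 < a" "p 0 < a\<^sup>2"
    and deriv: "\<And>x. 0 \<le> x \<Longrightarrow> x \<le> t \<Longrightarrow> (p has_real_derivative p' x) (at x)"
    and nonneg: "\<And>x. 0 \<le> x \<Longrightarrow> x \<le> t \<Longrightarrow> 0 \<le> p x"
    and sc: "\<And>x. 0 \<le> x \<Longrightarrow> x \<le> t \<Longrightarrow> \<bar>p' x\<bar> \<le> 2 * p x powr (3/2)"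
  shows "(a / (1 + a * t))\<^sup>2 - (a\<^sup>2 - p 0) \<le> p t"
    and "a * t < 1 \<Longrightarrow> p t \<le> (a / (1 - a * t))\<^sup>2"
proof -
  define \<eta> where "\<eta> = a\<^sup>2 - p 0"
  define q where "q = sqrt (p t + \<eta>)"
  have \<eta>: "0 < \<eta>" using a by (simp add: \<eta>_def)
  have pos: "0 < p t + \<eta>" using nonneg[of t] t \<eta> by auto
  then have q: "0 < q" "q\<^sup>2 = p t + \<eta>" by (auto simp: q_def)
  have "(a\<^sup>2) powr (-1/2) = 1 / sqrt (a\<^sup>2)" using a by (intro powr_minus_half) auto
  then have "(p 0 + \<eta>) powr (-1/2) = 1 / a" using a by (simp add: \<eta>_def)
  moreover have "(p t + \<eta>) powr (-1/2) = 1 / q" unfolding q_def using pos by (rule powr_minus_half)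
  ultimately have *: "\<bar>1 / q - 1 / a\<bar> \<le> t"
    using self_concordant_inverse_sqrt[OF t \<eta> deriv nonneg sc] by simp
  have "1 / q \<le> (1 + a * t) / a" using * a by (simp add: field_simps abs_le_iff)
  then have "a / (1 + a * t) \<le> q" using a t q by (simp add: divide_simps add_pos_nonneg) (simp add: algebra_simps)
  then have "(a / (1 + a * t))\<^sup>2 \<le> q\<^sup>2" using a t by (intro power_mono) auto
  then show "(a / (1 + a * t))\<^sup>2 - (a\<^sup>2 - p 0) \<le> p t" by (simp add: q \<eta>_def)
  show "p t \<le> (a / (1 - a * t))\<^sup>2" if "a * t < 1"
  proof -
    have "(1 - a * t) / a \<le> 1 / q" using * a by (simp add: field_simps abs_le_iff)
    then have "q \<le> a / (1 - a * t)" using a that q by (simp add: divide_simps) (simp add: algebra_simps)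
    then have "q\<^sup>2 \<le> (a / (1 - a * t))\<^sup>2" using q by (intro power_mono) auto
    then show ?thesis using q \<eta> by simp
  qed
qed

section \<open>Logarithmically homogeneous barriers: convexity and derivatives\<close>

locale lh_barrier =
  fixes K :: "(real^'m) set" and f :: "real^'m \<Rightarrow> ereal" and \<theta> :: real
  assumes regular: "regular_cone K" and barrier: "lhscb \<theta> K f" and \<theta>: "\<theta> \<ge> 1"
begin

lemma cone_facts: "cone K" "closed K" "convex K" "interior K \<noteq> {}"
  using regular by (auto simp: regular_cone_def)

lemma convex_interior_K: "convex (interior K)"
  using cone_facts by (simp add: convex_interior)

lemma not_MInf: "f u \<noteq> - \<infinity>"
  using barrier by (auto simp: lhscb_def)

lemma eff_domain: "effdom f = interior K"
  using barrier by (auto simp: lhscb_def)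

lemma f_eq_fin: "u \<in> interior K \<Longrightarrow> f u = ereal (fin f u)"
  using eff_domain not_MInf[of u] by (auto simp: effdom_def ereal_real)

lemma f_outside: "u \<notin> interior K \<Longrightarrow> f u = \<infinity>"
  using eff_domain by (auto simp: effdom_def)

lemma has_grad: "u \<in> interior K \<Longrightarrow> (fin f has_derivative (\<lambda>w. w \<bullet> grad f u)) (at u)"
  using barrier differentiable_imp_GDERIV[of "fin f" u] grad_eqI[of f u]
  unfolding lhscb_def gderiv_def by metis

lemma has_hess: "u \<in> interior K \<Longrightarrow> (grad f has_derivative (\<lambda>w. hess f u *v w)) (at u)"
proof -
  assume "u \<in> interior K"
  then have *: "(grad f has_derivative frechet_derivative (grad f) (at u)) (at u)"
    using barrier unfolding lhscb_def by (simp add: frechet_derivative_works)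
  then have "linear (frechet_derivative (grad f) (at u))" by (rule has_derivative_linear)
  then have "frechet_derivative (grad f) (at u) = (\<lambda>w. hess f u *v w)"
    unfolding hess_def by (simp add: matrix_vector_mul)
  then show ?thesis using * by simp
qed

lemma has_third: "u \<in> interior K \<Longrightarrow> (hess f has_derivative frechet_derivative (hess f) (at u)) (at u)"
  using barrier unfolding lhscb_def by (simp add: frechet_derivative_works)

lemma line_derivative: "((\<lambda>t. u + t *\<^sub>R w) has_derivative (\<lambda>s. s *\<^sub>R w)) (at t)"
  for u w :: "real^'m"
  by (auto intro!: derivative_eq_intros)

lemma line_first_derivative:
  assumes "u + t *\<^sub>R w \<in> interior K"
  shows "((\<lambda>t. fin f (u + t *\<^sub>R w)) has_real_derivative (grad f (u + t *\<^sub>R w) \<bullet> w)) (at t)"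
  using has_derivative_compose[OF line_derivative has_grad[OF assms]]
  by (simp add: has_field_derivative_def inner_commute mult_commute_abs)

lemma line_second_derivative:
  assumes "u + t *\<^sub>R w \<in> interior K"
  shows "((\<lambda>t. grad f (u + t *\<^sub>R w) \<bullet> w) has_real_derivative (w \<bullet> (hess f (u + t *\<^sub>R w) *v w))) (at t)"
  using has_derivative_inner_left[OF has_derivative_compose[OF line_derivative has_hess[OF assms]], of w]
  by (simp add: has_field_derivative_def inner_commute mult_commute_abs matrix_vector_mult_scaleR)

lemma line_third_derivative:
  assumes "u + t *\<^sub>R w \<in> interior K"
  shows "((\<lambda>t. w \<bullet> (hess f (u + t *\<^sub>R w) *v w)) has_real_derivative third_deriv f (u + t *\<^sub>R w) w) (at t)"
proof -
  have bl: "bounded_linear (\<lambda>M::real^'m^'m. w \<bullet> (M *v w))"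
    by (intro linear_conv_bounded_linear[THEN iffD1] linearI)
      (auto simp: matrix_vector_mult_add_rdistrib inner_add_right scaleR_matrix_vector_assoc[symmetric])
  let ?L = "frechet_derivative (hess f) (at (u + t *\<^sub>R w))"
  have lin: "linear ?L" using has_third[OF assms] by (rule has_derivative_linear)
  have "((\<lambda>t. w \<bullet> (hess f (u + t *\<^sub>R w) *v w)) has_derivative (\<lambda>s. w \<bullet> (?L (s *\<^sub>R w) *v w))) (at t)"
    using bounded_linear.has_derivative[OF bl has_derivative_compose[OF line_derivative has_third[OF assms]]] .
  moreover have "w \<bullet> (?L (s *\<^sub>R w) *v w) = s * third_deriv f (u + t *\<^sub>R w) w" for s
    by (simp add: linear_scale[OF lin] third_deriv_def scaleR_matrix_vector_assoc[symmetric])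
  ultimately show ?thesis by (simp add: has_field_derivative_def mult_commute_abs)
qed

lemma open_line_parameters: "open {t. u + t *\<^sub>R w \<in> interior K}"
  by (rule open_vimage[of "interior K" "\<lambda>t. u + t *\<^sub>R w", unfolded vimage_def])
    (auto intro!: continuous_intros)

lemma f_strictly_convex:
  assumes "u \<in> interior K" "v \<in> interior K" "u \<noteq> v" "0 < t" "t < 1"
  shows "fin f ((1 - t) *\<^sub>R u + t *\<^sub>R v) < (1 - t) * fin f u + t * fin f v"
  using barrier assms unfolding lhscb_def by blast

lemma f_convex:
  assumes "u \<in> interior K" "v \<in> interior K" "0 \<le> t" "t \<le> 1"
  shows "fin f ((1 - t) *\<^sub>R u + t *\<^sub>R v) \<le> (1 - t) * fin f u + t * fin f v"
proof (cases "u = v \<or> t = 0 \<or> t = 1")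
  case True
  then show ?thesis by (auto simp: scaleR_left_diff_distrib left_diff_distrib)
next
  case False
  then show ?thesis using f_strictly_convex[of u v t] assms by auto
qed

lemma above_tangent:
  assumes u: "u \<in> interior K" and v: "v \<in> interior K"
  shows "fin f u + grad f u \<bullet> (v - u) \<le> fin f v"
proof (rule ccontr)
  assume "\<not> ?thesis"
  then have neg: "0 < grad f u \<bullet> (v - u) - (fin f v - fin f u)" by simp
  let ?x = "\<lambda>t. fin f (u + t *\<^sub>R (v - u)) - t * (fin f v - fin f u)"
  have "(?x has_real_derivative (grad f u \<bullet> (v - u) - (fin f v - fin f u))) (at 0)"
    using line_first_derivative[of u 0 "v - u"] u by (auto intro!: derivative_eq_intros)
  then obtain e where e: "e > 0" "\<And>h. 0 < h \<Longrightarrow> h < e \<Longrightarrow> ?x 0 < ?x (0 + h)"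
    using DERIV_pos_inc_right[OF _ neg] by blast
  define h where "h = min (e / 2) 1"
  have h: "0 < h" "h < e" "h \<le> 1" using e by (auto simp: h_def)
  have "u + h *\<^sub>R (v - u) = (1 - h) *\<^sub>R u + h *\<^sub>R v" by (simp add: algebra_simps)
  then show False using e(2)[OF h(1,2)] f_convex[OF u v, of h] h by (simp add: algebra_simps)
qed

text \<open>The tangent at \<open>u\<close> lies below the graph at the midpoint, where the graph is strictly below the chord.\<close>

lemma above_tangent_strict:
  assumes u: "u \<in> interior K" and v: "v \<in> interior K" and "u \<noteq> v"
  shows "fin f u + grad f u \<bullet> (v - u) < fin f v"
proof -
  let ?m = "(1 - 1/2) *\<^sub>R u + (1/2) *\<^sub>R v"
  have m: "?m \<in> interior K" using convexD[OF convex_interior_K u v, of "1 - 1/2" "1/2"] by simp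
  have "?m - u = (1/2) *\<^sub>R (v - u)" by (simp add: vec_eq_iff field_simps)
  then have "fin f u + (1/2) * (grad f u \<bullet> (v - u)) \<le> fin f ?m"
    using above_tangent[OF u m] by simp
  also have "\<dots> < (1 - 1/2) * fin f u + (1/2) * fin f v"
    using assms by (intro f_strictly_convex) auto
  finally show ?thesis by simp
qed

text \<open>The gradient is monotone along lines by convexity.\<close>

lemma hess_nonneg:
  assumes u: "u \<in> interior K"
  shows "0 \<le> w \<bullet> (hess f u *v w)"
proof (rule ccontr)
  assume "\<not> ?thesis"
  then have neg: "w \<bullet> (hess f u *v w) < 0" by simp
  define \<phi>' where "\<phi>' = (\<lambda>t. grad f (u + t *\<^sub>R w) \<bullet> w)"
  have "(\<phi>' has_real_derivative (w \<bullet> (hess f u *v w))) (at 0)"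
    using line_second_derivative[of u 0 w] u by (simp add: \<phi>'_def)
  from DERIV_neg_dec_right[OF this neg]
  obtain e where e: "e > 0" "\<And>h. 0 < h \<Longrightarrow> h < e \<Longrightarrow> \<phi>' (0 + h) < \<phi>' 0" by blast
  have "0 \<in> {t. u + t *\<^sub>R w \<in> interior K}" using u by simp
  then obtain e' where e': "e' > 0" "ball 0 e' \<subseteq> {t. u + t *\<^sub>R w \<in> interior K}"
    using open_line_parameters open_contains_ball by blast
  define h where "h = min e e' / 2"
  have h: "0 < h" "h < e" "h \<in> ball 0 e'" using e e' by (auto simp: h_def)
  then have v: "u + h *\<^sub>R w \<in> interior K" using e'(2) by blast
  have "h * (grad f u \<bullet> w) \<le> h * (grad f (u + h *\<^sub>R w) \<bullet> w)"
    using above_tangent[OF u v] above_tangent[OF v u] by simp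
  then show False using e(2)[OF h(1,2)] h by (simp add: \<phi>'_def)
qed

section \<open>Self-concordance: the Dikin ellipsoid and the upper bound\<close>

lemma self_concordant_line:
  assumes "u + t *\<^sub>R w \<in> interior K"
  shows "\<bar>third_deriv f (u + t *\<^sub>R w) w\<bar> \<le> 2 * (w \<bullet> (hess f (u + t *\<^sub>R w) *v w)) powr (3/2)"
  using barrier assms unfolding lhscb_def by blast

lemma local_norm_sq: "u \<in> interior K \<Longrightarrow> (local_norm f u w)\<^sup>2 = w \<bullet> (hess f u *v w)"
  by (simp add: local_norm_def hess_nonneg)

lemma local_norm_nonneg: "0 \<le> local_norm f u w" if "u \<in> interior K"
  using hess_nonneg[OF that] by (simp add: local_norm_def)

text \<open>Integrate the bound on the second derivative along the segment twice. A number \<open>a\<close> strictly above the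
  local norm takes the place of the norm, so that directions of local norm zero are covered.\<close>

lemma segment_upper_bound:
  assumes T: "0 \<le> T" and a: "0 < a" "local_norm f u w < a" "a * T < 1"
    and seg: "\<And>t. 0 \<le> t \<Longrightarrow> t \<le> T \<Longrightarrow> u + t *\<^sub>R w \<in> interior K"
  shows "fin f (u + T *\<^sub>R w) \<le> fin f u + T * (grad f u \<bullet> w) - a * T - ln (1 - a * T)"
proof -
  have u: "u \<in> interior K" using seg[of 0] T by simp
  have at1: "a * t < 1" if "t \<le> T" for t
    using mult_left_mono[OF that less_imp_le[OF a(1)]] a(3) by linarith
  have q0: "w \<bullet> (hess f u *v w) < a\<^sup>2"
    using local_norm_sq[OF u, of w] local_norm_nonneg[OF u] a by (metis power_strict_mono zero_less_numeral)
  have grad_bound: "grad f (u + t *\<^sub>R w) \<bullet> w \<le> grad f u \<bullet> w + a / (1 - a * t) - a"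
    if t: "0 \<le> t" "t \<le> T" for t
  proof -
    let ?p = "\<lambda>s. a / (1 - a * s) - grad f (u + s *\<^sub>R w) \<bullet> w"
    have "?p 0 \<le> ?p t"
    proof (rule DERIV_nonneg_imp_nondecreasing[OF t(1)])
      fix s assume s: "0 \<le> s" "s \<le> t"
      have s1: "a * s < 1" using at1 s t by simp
      have in_K: "u + x *\<^sub>R w \<in> interior K" if "0 \<le> x" "x \<le> s" for x
        using that s t by (intro seg) auto
      have "((\<lambda>s. a / (1 - a * s)) has_real_derivative (a / (1 - a * s))\<^sup>2) (at s)"
        using s1 by (auto intro!: derivative_eq_intros simp: power2_eq_square)
      then have "(?p has_real_derivative ((a / (1 - a * s))\<^sup>2 - w \<bullet> (hess f (u + s *\<^sub>R w) *v w))) (at s)"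
        by (rule DERIV_diff) (use in_K s line_second_derivative in blast)
      moreover have "w \<bullet> (hess f (u + s *\<^sub>R w) *v w) \<le> (a / (1 - a * s))\<^sup>2"
        using self_concordant_second_derivative_bounds(2)
            [where p = "\<lambda>s. w \<bullet> (hess f (u + s *\<^sub>R w) *v w)",
              OF s(1) a(1) _ line_third_derivative[OF in_K] hess_nonneg[OF in_K] self_concordant_line[OF in_K] s1]
          q0 by simp
      ultimately show "\<exists>y. (?p has_real_derivative y) (at s) \<and> 0 \<le> y"
        by - (rule exI, rule conjI, assumption, simp)
    qed
    then show ?thesis by simp
  qed
  let ?p = "\<lambda>t. t * (grad f u \<bullet> w) - a * t - ln (1 - a * t) - fin f (u + t *\<^sub>R w)"
  have "?p 0 \<le> ?p T"
  proof (rule DERIV_nonneg_imp_nondecreasing[OF T])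
    fix t assume t: "0 \<le> t" "t \<le> T"
    have "((\<lambda>t. t * (grad f u \<bullet> w) - a * t - ln (1 - a * t)) has_real_derivative
        (grad f u \<bullet> w - a + a / (1 - a * t))) (at t)"
      using at1[OF t(2)] by (auto intro!: derivative_eq_intros)
    then have "(?p has_real_derivative
        (grad f u \<bullet> w - a + a / (1 - a * t) - grad f (u + t *\<^sub>R w) \<bullet> w)) (at t)"
      by (rule DERIV_diff) (rule line_first_derivative[OF seg[OF t]])
    then show "\<exists>y. (?p has_real_derivative y) (at t) \<and> 0 \<le> y"
      using grad_bound[OF t] by - (rule exI, rule conjI, assumption, simp)
  qed
  then show ?thesis by simp
qed

lemma frontier_blowup:
  assumes "\<And>k::nat. x k \<in> interior K" "u \<notin> interior K" "x \<longlonglongrightarrow> u" "\<And>k. fin f (x k) \<le> B"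
  shows False
proof -
  have "u \<in> K"
    using closed_sequentially[OF cone_facts(2) _ assms(3)] assms(1) interior_subset by blast
  then have "u \<in> frontier K" using assms(2) cone_facts(2) by (simp add: frontier_def)
  then have "(\<lambda>k. f (x k)) \<longlonglongrightarrow> \<infinity>"
    using barrier assms(1,3) unfolding lhscb_def by blast
  moreover have "\<And>k. f (x k) \<le> ereal B"
    by (subst f_eq_fin[OF assms(1)]) (simp add: assms(4))
  ultimately have "\<infinity> \<le> ereal B"
    by (intro tendsto_upperbound[of "\<lambda>k. f (x k)" "\<infinity>" sequentially]) auto
  then show False by simp
qed

text \<open>If the segment left the interior, then \<open>f\<close> would tend to infinity at the first exit point, where it is
  bounded by the preceding estimate.\<close>

lemma dikin:
  assumes u: "u \<in> interior K" and w: "local_norm f u w < 1"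
  shows "u + w \<in> interior K"
proof (rule ccontr)
  assume out: "u + w \<notin> interior K"
  define S where "S = {0..1} \<inter> - {t. u + t *\<^sub>R w \<in> interior K}"
  have S: "compact S" unfolding S_def using open_line_parameters by (intro compact_Int_closed) auto
  have "1 \<in> S" using out by (simp add: S_def)
  then obtain T where T: "T \<in> S" "\<And>t. t \<in> S \<Longrightarrow> T \<le> t" using compact_attains_inf[OF S] by auto
  have in_seg: "u + t *\<^sub>R w \<in> interior K" if "0 \<le> t" "t < T" for t
    using that T by (force simp: S_def)
  have T01: "0 < T" "T \<le> 1" "u + T *\<^sub>R w \<notin> interior K"
  proof -
    have "T \<noteq> 0" using T(1) u by (auto simp: S_def)
    moreover have "0 \<le> T" "T \<le> 1" "u + T *\<^sub>R w \<notin> interior K" using T(1) unfolding S_def by auto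
    ultimately show "0 < T" "T \<le> 1" "u + T *\<^sub>R w \<notin> interior K" by linarith+
  qed
  \<comment> \<open>any number strictly between the local norm and \<open>1\<close>\<close>
  define a where "a = (1 + local_norm f u w) / 2"
  have a: "0 < a" "local_norm f u w < a" "a < 1" using w local_norm_nonneg[OF u, of w] by (auto simp: a_def)
  define t where "t k = T * (1 - 1 / real (Suc k))" for k
  have t: "0 \<le> t k" "t k < T" for k using T01 by (auto simp: t_def field_simps)
  have "t \<longlonglongrightarrow> T * (1 - 0)"
    unfolding t_def by (intro tendsto_intros LIMSEQ_inverse_real_of_nat[unfolded inverse_eq_divide])
  then have lim: "(\<lambda>k. u + t k *\<^sub>R w) \<longlonglongrightarrow> u + T *\<^sub>R w" by (auto intro!: tendsto_intros)
  have "fin f (u + t k *\<^sub>R w) \<le> fin f u + \<bar>grad f u \<bullet> w\<bar> - ln (1 - a)" for k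
  proof -
    have t1: "t k \<le> 1" using t[of k] T01 by simp
    have at: "a * t k \<le> a" using a t1 by simp
    have at1: "a * t k < 1" using at a(3) by linarith
    have "fin f (u + t k *\<^sub>R w) \<le> fin f u + t k * (grad f u \<bullet> w) - a * t k - ln (1 - a * t k)"
      using at1 a t[of k] by (intro segment_upper_bound in_seg) auto
    moreover have "t k * (grad f u \<bullet> w) \<le> \<bar>grad f u \<bullet> w\<bar>"
      using t[of k] t1 mult_left_le_one_le[of "\<bar>grad f u \<bullet> w\<bar>" "t k"]
      by (smt (verit) abs_ge_zero mult_left_mono abs_ge_self)
    moreover have "ln (1 - a) \<le> ln (1 - a * t k)" using at at1 a by (subst ln_le_cancel_iff) auto
    moreover have "0 \<le> a * t k" using a t[of k] by simp
    ultimately show ?thesis by linarith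
  qed
  then show False using frontier_blowup[OF in_seg[OF t] T01(3) lim] by blast
qed

lemma self_concordant_upper_bound:
  assumes u: "u \<in> interior K" and w: "local_norm f u w < 1"
  shows "fin f (u + w) \<le> fin f u + grad f u \<bullet> w - local_norm f u w - ln (1 - local_norm f u w)"
proof (rule tendsto_lowerbound)
  let ?D = "local_norm f u w"
  show "((\<lambda>a. fin f u + grad f u \<bullet> w - a - ln (1 - a)) \<longlongrightarrow>
      fin f u + grad f u \<bullet> w - ?D - ln (1 - ?D)) (at_right ?D)"
    using w by (auto intro!: tendsto_intros)
  have seg: "u + t *\<^sub>R w \<in> interior K" if "0 \<le> t" "t \<le> 1" for t
    using convexD_alt[OF convex_interior_K u dikin[OF u w] that] by (simp add: algebra_simps)
  have "fin f (u + w) \<le> fin f u + grad f u \<bullet> w - a - ln (1 - a)" if "?D < a" "a < 1" for a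
    using segment_upper_bound[of 1 a u w] seg that local_norm_nonneg[OF u, of w] by simp
  then show "\<forall>\<^sub>F a in at_right ?D. fin f (u + w) \<le> fin f u + grad f u \<bullet> w - a - ln (1 - a)"
    using w eventually_at_right_real[OF w] by (auto elim!: eventually_mono)
qed simp

section \<open>Logarithmic homogeneity: recession directions\<close>

lemma K_add: "u \<in> K \<Longrightarrow> v \<in> K \<Longrightarrow> u + v \<in> K"
  and K_scale: "u \<in> K \<Longrightarrow> 0 \<le> c \<Longrightarrow> c *\<^sub>R u \<in> K"
  using cone_facts(1,3) convex_cone[of K] by auto

lemma interior_K_add:
  assumes u: "u \<in> interior K" and v: "v \<in> K"
  shows "u + v \<in> interior K"
proof (rule interiorI)
  show "open ((\<lambda>x. v + x) ` interior K)" by (intro open_translation) simp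
  show "(\<lambda>x. v + x) ` interior K \<subseteq> K" using K_add v interior_subset by blast
qed (use u in \<open>auto simp: add.commute\<close>)

lemma interior_K_scale:
  assumes u: "u \<in> interior K" and c: "0 < c"
  shows "c *\<^sub>R u \<in> interior K"
proof (rule interiorI)
  show "open ((\<lambda>x. c *\<^sub>R x) ` interior K)" using c by (intro open_scaling) auto
  show "(\<lambda>x. c *\<^sub>R x) ` interior K \<subseteq> K" using K_scale c interior_subset by fastforce
qed (use u in auto)

lemma f_scale:
  assumes u: "u \<in> interior K" and t: "0 < t"
  shows "fin f (t *\<^sub>R u) = fin f u - \<theta> * ln t"
proof -
  have "f (t *\<^sub>R u) = f u - ereal (\<theta> * ln t)"
    using barrier u t unfolding lhscb_def by blast
  then show ?thesis using f_eq_fin[OF u] by (cases "f u") auto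
qed

lemma zero_notin_interior_K: "0 \<notin> interior K"
proof
  assume "0 \<in> interior K"
  from f_scale[OF this, of 2] show False using \<theta> by simp
qed

lemma grad_inner_self:
  assumes u: "u \<in> interior K"
  shows "grad f u \<bullet> u = - \<theta>"
proof (rule DERIV_unique)
  show "((\<lambda>t. fin f (u + t *\<^sub>R u)) has_real_derivative (grad f u \<bullet> u)) (at 0)"
    using line_first_derivative[of u 0 u] u by simp
  have "((\<lambda>t. fin f u - \<theta> * ln (1 + t)) has_real_derivative - \<theta>) (at 0)"
    by (auto intro!: derivative_eq_intros)
  then show "((\<lambda>t. fin f (u + t *\<^sub>R u)) has_real_derivative - \<theta>) (at 0)"
  proof (rule has_field_derivative_transform_within_open[where S = "{-1<..}"])
    show "fin f u - \<theta> * ln (1 + t) = fin f (u + t *\<^sub>R u)" if "t \<in> {-1<..}" for t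
      using f_scale[OF u, of "1 + t"] that by (simp add: scaleR_add_left)
  qed auto
qed

text \<open>Differentiate \<open>f(t x) = f(x) - \<theta> ln t\<close> with respect to \<open>x\<close>.\<close>

lemma grad_scale:
  assumes u: "u \<in> interior K" and t: "0 < t"
  shows "grad f (t *\<^sub>R u) = (1 / t) *\<^sub>R grad f u"
proof -
  have "((\<lambda>x. fin f (t *\<^sub>R x)) has_derivative (\<lambda>w. (t *\<^sub>R w) \<bullet> grad f (t *\<^sub>R u))) (at u)"
    using has_derivative_compose[where f = "\<lambda>x. t *\<^sub>R x" and g = "fin f",
        OF has_derivative_scaleR_right[OF has_derivative_ident] has_grad[OF interior_K_scale[OF u t]]] .
  then have "((\<lambda>x. fin f x - \<theta> * ln t) has_derivative (\<lambda>w. (t *\<^sub>R w) \<bullet> grad f (t *\<^sub>R u))) (at u)"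
    by (rule has_derivative_transform_within_open[where s = "interior K"]) (use u t f_scale in auto)
  then have "(fin f has_derivative (\<lambda>w. (t *\<^sub>R w) \<bullet> grad f (t *\<^sub>R u))) (at u)"
    using has_derivative_add_const[of "\<lambda>x. fin f x - \<theta> * ln t" _ _ "\<theta> * ln t"] by simp
  then have "GDERIV (fin f) u :> t *\<^sub>R grad f (t *\<^sub>R u)" by (simp add: gderiv_def)
  then have "grad f u = t *\<^sub>R grad f (t *\<^sub>R u)" by (rule grad_eqI)
  then show ?thesis using t by simp
qed

text \<open>Differentiate \<open>\<nabla>f(t u) = \<nabla>f(u) / t\<close> with respect to \<open>t\<close>.\<close>

lemma hess_mult_self:
  assumes u: "u \<in> interior K"
  shows "w \<bullet> (hess f u *v u) = - (grad f u \<bullet> w)"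
proof (rule DERIV_unique)
  have "((\<lambda>t. grad f (u + t *\<^sub>R u)) has_derivative (\<lambda>s. hess f u *v (s *\<^sub>R u))) (at 0)"
    using has_derivative_compose[OF line_derivative[of u u 0], of "grad f"] has_hess[OF u] by simp
  from has_derivative_inner_left[OF this, of w]
  show "((\<lambda>t. grad f (u + t *\<^sub>R u) \<bullet> w) has_real_derivative (w \<bullet> (hess f u *v u))) (at 0)"
    by (simp add: has_field_derivative_def inner_commute mult_commute_abs matrix_vector_mult_scaleR)
  have "((\<lambda>t. (1 / (1 + t)) * (grad f u \<bullet> w)) has_real_derivative - (grad f u \<bullet> w)) (at 0)"
    by (auto intro!: derivative_eq_intros)
  then show "((\<lambda>t. grad f (u + t *\<^sub>R u) \<bullet> w) has_real_derivative - (grad f u \<bullet> w)) (at 0)"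
  proof (rule has_field_derivative_transform_within_open[where S = "{-1<..}"])
    show "(1 / (1 + t)) * (grad f u \<bullet> w) = grad f (u + t *\<^sub>R u) \<bullet> w" if "t \<in> {-1<..}" for t
      using grad_scale[OF u, of "1 + t"] that by (simp add: scaleR_add_left)
  qed auto
qed

text \<open>Differentiate \<open>\<langle>\<nabla>f(x), x\<rangle> = - \<theta>\<close> with respect to \<open>x\<close>. This and the preceding lemma give the two mixed
  terms of the squared local norm of \<open>v - u\<close>.\<close>

lemma self_inner_hess:
  assumes u: "u \<in> interior K"
  shows "u \<bullet> (hess f u *v w) = - (grad f u \<bullet> w)"
proof -
  have "((\<lambda>x. grad f x \<bullet> x) has_derivative (\<lambda>w. grad f u \<bullet> w + (hess f u *v w) \<bullet> u)) (at u)"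
    by (rule has_derivative_inner[OF has_hess[OF u] has_derivative_ident])
  then have "((\<lambda>x. - \<theta>) has_derivative (\<lambda>w. grad f u \<bullet> w + (hess f u *v w) \<bullet> u)) (at u)"
    by (rule has_derivative_transform_within_open[where s = "interior K"]) (use u grad_inner_self in auto)
  then have "(\<lambda>w. grad f u \<bullet> w + (hess f u *v w) \<bullet> u) = (\<lambda>w. 0)"
    using has_derivative_unique has_derivative_const by blast
  then have "grad f u \<bullet> w + (hess f u *v w) \<bullet> u = 0" by meson
  then show ?thesis by (simp add: inner_commute)
qed

text \<open>Along the ray through a point \<open>x\<close> of the interior the barrier tends to minus infinity, whereas its
  tangent at \<open>u\<close>, which lies below it, is affine with slope \<open>\<langle>\<nabla>f(u), x\<rangle>\<close>.\<close>

lemma grad_recession: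
  assumes u: "u \<in> interior K" and v: "v \<in> K"
  shows "grad f u \<bullet> v \<le> 0"
proof -
  have int: "grad f u \<bullet> x \<le> 0" if x: "x \<in> interior K" for x
  proof (rule ccontr)
    assume "\<not> ?thesis"
    then have c: "0 < grad f u \<bullet> x" by simp
    define B where "B = fin f x - fin f u + grad f u \<bullet> u"
    define t where "t = max 1 ((B + 1) / (grad f u \<bullet> x))"
    have t: "1 \<le> t" "(B + 1) / (grad f u \<bullet> x) \<le> t" by (auto simp: t_def)
    then have "B + 1 \<le> t * (grad f u \<bullet> x)" using c by (simp add: field_simps)
    moreover have "fin f u + grad f u \<bullet> (t *\<^sub>R x - u) \<le> fin f x - \<theta> * ln t"
      using above_tangent[OF u interior_K_scale[OF x, of t]] f_scale[OF x, of t] t by simp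
    moreover have "0 \<le> \<theta> * ln t" using t \<theta> by simp
    ultimately show False by (simp add: B_def inner_diff_right)
  qed
  show ?thesis
  proof (rule field_le_epsilon)
    fix e :: real assume e: "0 < e"
    then have "(e / \<theta>) *\<^sub>R u + v \<in> interior K"
      using \<theta> by (intro interior_K_add interior_K_scale u v) auto
    from int[OF this] show "grad f u \<bullet> v \<le> 0 + e"
      using \<theta> by (simp add: inner_add_right grad_inner_self[OF u])
  qed
qed

text \<open>The ray \<open>u + t v\<close> stays in the interior, so the slope of \<open>f\<close> along it is never positive. By
  self-concordance the second derivative decays no faster than \<open>a\<^sup>2 / (1 + a t)\<^sup>2\<close>, whose integral over the
  ray is \<open>a\<close>, where \<open>a\<close> is the local norm of \<open>v\<close>. Hence the initial slope is at most \<open>- a\<close>.\<close>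

lemma local_norm_le_recession:
  assumes u: "u \<in> interior K" and v: "v \<in> K"
  shows "local_norm f u v \<le> - (grad f u \<bullet> v)"
proof (rule field_le_epsilon)
  fix e :: real assume e: "0 < e"
  \<comment> \<open>For a finite time \<open>T\<close> and the shift \<open>1 / T\<^sup>2\<close> of the second derivative, the error of the
    argument is at most \<open>2 / T\<close>.\<close>
  define T where "T = 2 / e"
  have T: "0 < T" using e by (simp add: T_def)
  define q where "q t = v \<bullet> (hess f (u + t *\<^sub>R v) *v v)" for t
  define a where "a = sqrt (q 0 + 1 / T\<^sup>2)"
  have in_K: "u + t *\<^sub>R v \<in> interior K" if "0 \<le> t" for t
    using interior_K_add[OF u K_scale[OF v that]] .
  have q0: "0 \<le> q 0" using hess_nonneg[OF u] by (simp add: q_def)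
  have a2: "a\<^sup>2 = q 0 + 1 / T\<^sup>2" using q0 by (simp add: a_def)
  have a: "0 < a" using q0 T by (simp add: a_def add_nonneg_pos)
  let ?p = "\<lambda>t. grad f (u + t *\<^sub>R v) \<bullet> v + a / (1 + a * t) + t / T\<^sup>2"
  have "?p 0 \<le> ?p T"
  proof (rule DERIV_nonneg_imp_nondecreasing[where f = ?p])
    fix t assume t: "0 \<le> t" "t \<le> T"
    have "1 + a * t > 0" using a t by (simp add: add_pos_nonneg)
    then have "((\<lambda>t. a / (1 + a * t)) has_real_derivative - (a / (1 + a * t))\<^sup>2) (at t)"
      by (auto intro!: derivative_eq_intros simp: power2_eq_square)
    moreover have "((\<lambda>t. t / T\<^sup>2) has_real_derivative 1 / T\<^sup>2) (at t)"
      by (rule DERIV_cdivide[OF DERIV_ident])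
    moreover have "((\<lambda>t. grad f (u + t *\<^sub>R v) \<bullet> v) has_real_derivative q t) (at t)"
      unfolding q_def by (rule line_second_derivative[OF in_K[OF t(1)]])
    ultimately have "(?p has_real_derivative (q t + - (a / (1 + a * t))\<^sup>2 + 1 / T\<^sup>2)) (at t)"
      by (intro DERIV_add)
    moreover have "(a / (1 + a * t))\<^sup>2 - (a\<^sup>2 - q 0) \<le> q t"
      using self_concordant_second_derivative_bounds(1)
          [where p = q and p' = "\<lambda>s. third_deriv f (u + s *\<^sub>R v) v", OF t(1) a]
        line_third_derivative[OF in_K] hess_nonneg[OF in_K] self_concordant_line[OF in_K] T a2
      by (simp add: q_def[abs_def])
    ultimately show "\<exists>y. (?p has_real_derivative y) (at t) \<and> 0 \<le> y"
      using a2 by - (rule exI, rule conjI, assumption, simp)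
  qed (use T in auto)
  moreover have "grad f (u + T *\<^sub>R v) \<bullet> v \<le> 0"
    by (rule grad_recession[OF in_K[OF less_imp_le[OF T]] v])
  ultimately have "a \<le> - (grad f u \<bullet> v) + (a / (1 + a * T) + T / T\<^sup>2)" by simp
  also have "a / (1 + a * T) \<le> 1 / T" using a T by (simp add: field_simps add_pos_pos)
  also have "T / T\<^sup>2 = 1 / T" by (simp add: power2_eq_square)
  also have "1 / T + 1 / T = e" using e by (simp add: T_def)
  finally have "a \<le> - (grad f u \<bullet> v) + e" by simp
  moreover have "local_norm f u v \<le> a"
    unfolding a_def local_norm_def q_def by (intro real_sqrt_le_mono) simp
  ultimately show "local_norm f u v \<le> - (grad f u \<bullet> v) + e" by simp
qed

lemma local_norm_minus: "local_norm f u (v - w) = local_norm f u (w - v)"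
  by (simp add: local_norm_def matrix_vector_mult_diff_distrib inner_diff_left inner_diff_right)

text \<open>With \<open>p = - \<langle>\<nabla>f(u), v\<rangle>\<close> the square of the local norm of \<open>v - u\<close> is at most \<open>p\<^sup>2 - 2 p + \<theta>\<close>.\<close>

lemma local_norm_diff_le:
  assumes u: "u \<in> interior K" and v: "v \<in> K" and P: "- (grad f u \<bullet> v) \<le> P" "\<theta> \<le> P"
  shows "local_norm f u (v - u) \<le> P"
proof -
  define p where "p = - (grad f u \<bullet> v)"
  have p: "0 \<le> p" "p \<le> P" using grad_recession[OF u v] P by (auto simp: p_def)
  have "(local_norm f u (v - u))\<^sup>2 = (local_norm f u v)\<^sup>2 - 2 * p + \<theta>"
    by (simp add: local_norm_sq[OF u] p_def matrix_vector_mult_diff_distrib inner_diff_left inner_diff_right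
        hess_mult_self[OF u] self_inner_hess[OF u] grad_inner_self[OF u])
  also have "(local_norm f u v)\<^sup>2 \<le> p\<^sup>2"
    using local_norm_le_recession[OF u v] local_norm_nonneg[OF u, of v] by (intro power_mono) (auto simp: p_def)
  also have "p\<^sup>2 - 2 * p + \<theta> \<le> P\<^sup>2"
  proof (cases "2 \<le> p")
    case True
    then have "p * (p - 2) \<le> P * (P - 2)" using p by (intro mult_mono) auto
    then show ?thesis using P \<theta> by (simp add: power2_eq_square algebra_simps)
  next
    case False
    then have "p * (p - 2) \<le> 0" using p by (simp add: mult_le_0_iff)
    moreover have "P \<le> P * P" using P \<theta> by simp
    ultimately show ?thesis using P by (simp add: power2_eq_square algebra_simps)
  qed
  finally have "(local_norm f u (v - u))\<^sup>2 \<le> P\<^sup>2" by simp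
  then show ?thesis by (rule power2_le_imp_le) (use P \<theta> in simp)
qed

section \<open>The conjugate barrier\<close>

lemma minimizer_grad:
  assumes u: "u \<in> interior K"
    and min: "\<And>x. x \<in> interior K \<Longrightarrow> fin f u - y \<bullet> u \<le> fin f x - y \<bullet> x"
  shows "grad f u = y"
proof -
  have "((\<lambda>x. fin f x - y \<bullet> x) has_derivative (\<lambda>w. w \<bullet> grad f u - y \<bullet> w)) (at u)"
    by (intro has_derivative_diff has_grad[OF u] has_derivative_inner_right has_derivative_ident)
  then have "(\<lambda>w. w \<bullet> grad f u - y \<bullet> w) = (\<lambda>w. 0)"
    by (rule differential_zero_maxmin[OF u open_interior]) (use min in blast)
  then have "(grad f u - y) \<bullet> grad f u - y \<bullet> (grad f u - y) = 0" by meson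
  then have "(grad f u - y) \<bullet> (grad f u - y) = 0" by (simp add: inner_diff_left inner_diff_right inner_commute)
  then show ?thesis by simp
qed

lemma conjugate_le:
  assumes "\<And>x. x \<in> interior K \<Longrightarrow> y \<bullet> x - fin f x \<le> c"
  shows "conjugate f y \<le> ereal c"
  unfolding conjugate_def
proof (rule SUP_least)
  fix x
  show "ereal (y \<bullet> x) - f x \<le> ereal c"
  proof (cases "x \<in> interior K")
    case True
    show ?thesis by (subst f_eq_fin[OF True]) (use assms[OF True] in simp)
  qed (simp add: f_outside)
qed

lemma fenchel_young_f: "u \<in> interior K \<Longrightarrow> ereal (y \<bullet> u - fin f u) \<le> conjugate f y"
  using fenchel_young[of y u f] f_eq_fin[of u] by (metis ereal_minus(1))

lemma conjugate_not_MInf: "conjugate f y \<noteq> - \<infinity>"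
  using cone_facts(4) fenchel_young_f[of _ y] by fastforce

lemma conjugate_at_grad:
  assumes u: "u \<in> interior K"
  shows "conjugate f (grad f u) = ereal (grad f u \<bullet> u - fin f u)"
proof (rule antisym)
  show "conjugate f (grad f u) \<le> ereal (grad f u \<bullet> u - fin f u)"
    by (rule conjugate_le) (use above_tangent[OF u] in \<open>fastforce simp: inner_diff_right\<close>)
qed (rule fenchel_young_f[OF u])

lemma grad_of_fenchel_equality:
  assumes u: "u \<in> interior K" and eq: "conjugate f y \<le> ereal (y \<bullet> u - fin f u)"
  shows "y = grad f u"
proof (rule minimizer_grad[OF u, symmetric])
  fix x assume x: "x \<in> interior K"
  have "ereal (y \<bullet> x - fin f x) \<le> ereal (y \<bullet> u - fin f u)"
    using fenchel_young_f[OF x] eq by (rule order_trans)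
  then show "fin f u - y \<bullet> u \<le> fin f x - y \<bullet> x" by simp
qed

text \<open>Above its tangent at \<open>u\<close> the barrier has a positive minimum on a small sphere by strict convexity, and by
  convexity the excess grows at least linearly beyond that sphere.\<close>

lemma linear_growth:
  assumes u: "u \<in> interior K" and e: "e > 0"
  obtains d m where "0 < d" "d \<le> e" "0 < m"
    "\<And>v. v \<in> interior K \<Longrightarrow> d \<le> norm (v - u) \<Longrightarrow>
      fin f u + grad f u \<bullet> (v - u) + m * norm (v - u) \<le> fin f v"
proof -
  obtain d0 where d0: "d0 > 0" "cball u d0 \<subseteq> interior K"
    using u open_interior open_contains_cball by blast
  define d where "d = min d0 e"
  have d: "0 < d" "d \<le> e" "cball u d \<subseteq> interior K" using d0 e by (auto simp: d_def)
  define g where "g v = fin f v - fin f u - grad f u \<bullet> (v - u)" for v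
  have sph: "sphere u d \<subseteq> interior K" using d(3) sphere_cball by blast
  have "continuous_on (sphere u d) (fin f)"
    by (rule continuous_on_subset[OF _ sph])
      (use has_derivative_continuous has_grad continuous_at_imp_continuous_on in blast)
  then have "continuous_on (sphere u d) g" unfolding g_def by (intro continuous_intros)
  moreover have "sphere u d \<noteq> {}" using d by simp
  ultimately obtain x where x: "x \<in> sphere u d" "\<And>v. v \<in> sphere u d \<Longrightarrow> g x \<le> g v"
    using continuous_attains_inf[of "sphere u d" g] by auto
  have gx: "0 < g x" using above_tangent_strict[OF u, of x] x sph d by (auto simp: g_def)
  have "fin f u + grad f u \<bullet> (v - u) + g x / d * norm (v - u) \<le> fin f v"
    if v: "v \<in> interior K" and far: "d \<le> norm (v - u)" for v
  proof -
    define l where "l = d / norm (v - u)"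
    have pos: "0 < norm (v - u)" using d far by linarith
    then have l: "0 < l" "l \<le> 1" using d far unfolding l_def by (auto simp: divide_le_eq_1)
    let ?x = "(1 - l) *\<^sub>R u + l *\<^sub>R v"
    have xu: "?x - u = l *\<^sub>R (v - u)" by (simp add: algebra_simps)
    then have "norm (?x - u) = d" using d pos by (simp add: l_def)
    then have "?x \<in> sphere u d" by (simp add: dist_norm norm_minus_commute)
    then have "g x \<le> g ?x" by (rule x(2))
    also have "\<dots> \<le> l * g v"
      using f_convex[OF u v, of l] l unfolding g_def xu by (simp add: algebra_simps)
    finally have "g x / l \<le> g v" using l by (simp add: field_simps)
    moreover have "g x / l = g x / d * norm (v - u)" by (simp add: l_def)
    ultimately show ?thesis by (simp add: g_def)
  qed
  then show ?thesis using that[OF d(1,2), of "g x / d"] gx d by simp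
qed

text \<open>If the slope is changed by a vector \<open>w\<close> shorter than the growth rate \<open>m\<close>, then in the supremum that
  defines \<open>f\<^sup>*(\<nabla>f(u) + w)\<close> no point at distance more than \<open>e\<close> from \<open>u\<close> beats \<open>u\<close> itself. The other points
  bound the error of the linearization by \<open>e \<parallel>w\<parallel>\<close>.\<close>

lemma GDERIV_conjugate:
  assumes u: "u \<in> interior K"
  shows "GDERIV (fin (conjugate f)) (grad f u) :> u"
  unfolding gderiv_def has_derivative_at_alt
proof (intro conjI allI impI)
  show "bounded_linear (\<lambda>w. w \<bullet> u)" by (rule bounded_linear_inner_left)
  fix e :: real assume e: "0 < e"
  let ?y = "grad f u"
  obtain d m where d: "0 < d" "d \<le> e" "0 < m" and
    growth: "\<And>v. v \<in> interior K \<Longrightarrow> d \<le> norm (v - u) \<Longrightarrow>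
      fin f u + ?y \<bullet> (v - u) + m * norm (v - u) \<le> fin f v"
    using linear_growth[OF u e] by metis
  have bound: "norm (fin (conjugate f) y' - fin (conjugate f) ?y - (y' - ?y) \<bullet> u) \<le> e * norm (y' - ?y)"
    if near: "norm (y' - ?y) < m" for y'
  proof -
    define w where "w = y' - ?y"
    have y': "y' = ?y + w" by (simp add: w_def)
    have up: "conjugate f y' \<le> ereal (y' \<bullet> u - fin f u + e * norm w)"
    proof (rule conjugate_le)
      fix x assume x: "x \<in> interior K"
      have cs: "w \<bullet> (x - u) \<le> norm w * norm (x - u)" by (rule norm_cauchy_schwarz)
      show "y' \<bullet> x - fin f x \<le> y' \<bullet> u - fin f u + e * norm w"
      proof (cases "d \<le> norm (x - u)")
        case True
        \<comment> \<open>far from \<open>u\<close> the growth of \<open>f\<close> absorbs the change of slope\<close>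
        have "norm w * norm (x - u) \<le> m * norm (x - u)"
          using near by (intro mult_right_mono) (auto simp: w_def)
        moreover have "0 \<le> e * norm w" using e by simp
        ultimately show ?thesis using growth[OF x True] cs
          by (simp add: y' inner_add_left inner_diff_right)
      next
        case False
        then have "norm w * norm (x - u) \<le> norm w * e" using d by (intro mult_left_mono) auto
        then show ?thesis using above_tangent[OF u x] cs
          by (simp add: y' inner_add_left inner_diff_right mult.commute)
      qed
    qed
    have low: "ereal (y' \<bullet> u - fin f u) \<le> conjugate f y'" by (rule fenchel_young_f[OF u])
    obtain r where r: "conjugate f y' = ereal r" using up low by (cases "conjugate f y'") auto
    show ?thesis using up low unfolding r conjugate_at_grad[OF u] w_def[symmetric]
      by (simp add: y' inner_add_left)
  qed
  then show "\<exists>d>0. \<forall>y'. norm (y' - ?y) < d \<longrightarrow>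
    norm (fin (conjugate f) y' - fin (conjugate f) ?y - (y' - ?y) \<bullet> u) \<le> e * norm (y' - ?y)"
    using d(3) by blast
qed

lemma grad_conjugate: "u \<in> interior K \<Longrightarrow> grad (conjugate f) (grad f u) = u"
  by (rule grad_eqI[OF GDERIV_conjugate])

text \<open>On the cone \<open>\<langle>y, v\<rangle>\<close> is at most \<open>- r \<parallel>v\<parallel>\<close>, which outweighs the logarithmic decrease of \<open>f\<close>. So
  \<open>f(v) - \<langle>y, v\<rangle>\<close> has bounded minimizing sequences, and the barrier property keeps their limits away from
  the frontier.\<close>

lemma grad_surj_interior_polar:
  assumes y: "y \<in> interior (polar K)"
  obtains u where "u \<in> interior K" "grad f u = y"
proof -
  obtain r where r: "0 < r" "cball y r \<subseteq> polar K"
    using y by (meson mem_interior_cball)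
  have decay: "y \<bullet> v \<le> - r * norm v" if v: "v \<in> K" for v
  proof (cases "v = 0")
    case False
    have "y + (r / norm v) *\<^sub>R v \<in> cball y r" using r False by (simp add: dist_norm)
    then have "(y + (r / norm v) *\<^sub>R v) \<bullet> v \<le> 0" using r v by (auto simp: polar_def)
    then show ?thesis using False
      by (simp add: inner_add_left power2_norm_eq_inner[symmetric] power2_eq_square)
  qed simp
  obtain e where e: "e \<in> interior K" using cone_facts(4) by blast
  define C where "C = - fin f e + norm (grad f e) * (1 + norm e) + \<theta> * ln (2 * \<theta> / r)"
  define g where "g v = fin f v - y \<bullet> v" for v
  have coercive: "r / 2 * norm v - C \<le> g v" if v: "v \<in> interior K" for v
  proof -
    have n: "0 < norm v" using zero_notin_interior_K v by auto
    define x where "x = (1 / norm v) *\<^sub>R v"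
    have x: "x \<in> interior K" "norm x = 1" "v = norm v *\<^sub>R x"
      using interior_K_scale[OF v] n by (auto simp: x_def)
    have "\<bar>grad f e \<bullet> (x - e)\<bar> \<le> norm (grad f e) * norm (x - e)" by (rule Cauchy_Schwarz_ineq2)
    also have "\<dots> \<le> norm (grad f e) * (1 + norm e)"
      using norm_triangle_ineq4[of x e] x by (intro mult_left_mono) auto
    finally have "fin f e - norm (grad f e) * (1 + norm e) \<le> fin f x"
      using above_tangent[OF e x(1)] by linarith
    moreover have "fin f v = fin f x - \<theta> * ln (norm v)" using f_scale[OF x(1) n] x(3) by simp
    moreover have "\<theta> * ln (norm v) \<le> r / 2 * norm v + \<theta> * ln (2 * \<theta> / r)"
    proof -
      have "ln (norm v) = ln (r * norm v / (2 * \<theta>)) + ln (2 * \<theta> / r)"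
        using r n \<theta> by (subst ln_mult_pos[symmetric]) auto
      also have "ln (r * norm v / (2 * \<theta>)) \<le> r * norm v / (2 * \<theta>)"
        using ln_le_minus_one[of "r * norm v / (2 * \<theta>)"] r n \<theta> by simp
      finally have "\<theta> * ln (norm v) \<le> \<theta> * (r * norm v / (2 * \<theta>) + ln (2 * \<theta> / r))"
        using \<theta> by (intro mult_left_mono) auto
      also have "\<dots> = r / 2 * norm v + \<theta> * ln (2 * \<theta> / r)" using \<theta> by (simp add: distrib_left)
      finally show ?thesis .
    qed
    moreover have "y \<bullet> v \<le> - r * norm v" using decay v interior_subset by blast
    ultimately show ?thesis unfolding C_def g_def by (simp add: field_simps)
  qed
  have low: "- C \<le> g v" if "v \<in> interior K" for v
  proof -
    have "0 \<le> r / 2 * norm v" using r by simp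
    then show ?thesis using coercive[OF that] by linarith
  qed
  then have bdd: "bdd_below (g ` interior K)" by (auto intro!: bdd_belowI2)
  define I where "I = Inf (g ` interior K)"
  have I: "I \<le> g v" if "v \<in> interior K" for v
    unfolding I_def using that bdd by (intro cInf_lower) auto
  have "\<exists>v\<in>interior K. g v < I + 1 / real (Suc k)" for k
    using cInf_lessD[of "g ` interior K" "I + 1 / real (Suc k)"] cone_facts(4) by (auto simp: I_def)
  then obtain x where x: "\<And>k. x k \<in> interior K" "\<And>k. g (x k) < I + 1 / real (Suc k)" by metis
  have gx: "g (x k) \<le> I + 1" for k
  proof -
    have "1 / real (Suc k) \<le> 1" by simp
    then show ?thesis using x(2)[of k] by linarith
  qed
  have nx: "norm (x k) \<le> 2 * (I + 1 + C) / r" for k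
    using coercive[OF x(1), of k] gx[of k] r by (simp add: field_simps)
  then have "bounded (range x)" by (auto simp: bounded_iff)
  then obtain l \<sigma> where \<sigma>: "strict_mono (\<sigma> :: nat \<Rightarrow> nat)" "(x \<circ> \<sigma>) \<longlonglongrightarrow> l"
    using bounded_imp_convergent_subsequence by blast
  have lK: "l \<in> interior K"
  proof (rule ccontr)
    assume "l \<notin> interior K"
    moreover have "fin f ((x \<circ> \<sigma>) k) \<le> I + 1 + norm y * (2 * (I + 1 + C) / r)" for k
    proof -
      have "y \<bullet> x (\<sigma> k) \<le> norm y * norm (x (\<sigma> k))" by (rule norm_cauchy_schwarz)
      also have "\<dots> \<le> norm y * (2 * (I + 1 + C) / r)" by (intro mult_left_mono nx) auto
      finally show ?thesis using gx[of "\<sigma> k"] by (simp add: g_def)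
    qed
    ultimately show False using frontier_blowup[of "x \<circ> \<sigma>" l] x(1) \<sigma>(2) by auto
  qed
  have "isCont (fin f) l" using has_derivative_continuous[OF has_grad[OF lK]] by simp
  then have "isCont g l" unfolding g_def by (intro continuous_intros)
  then have "(\<lambda>k. g ((x \<circ> \<sigma>) k)) \<longlonglongrightarrow> g l" using \<sigma>(2) by (rule isCont_tendsto_compose)
  moreover have "(\<lambda>k. I + 1 / real (Suc (\<sigma> k))) \<longlonglongrightarrow> I + 0"
    using LIMSEQ_subseq_LIMSEQ[OF LIMSEQ_inverse_real_of_nat \<sigma>(1)]
    by (intro tendsto_add tendsto_const) (simp add: o_def inverse_eq_divide)
  ultimately have "g l \<le> I + 0"
    by (rule LIMSEQ_le) (use x(2) in \<open>auto simp: less_imp_le simp del: of_nat_Suc\<close>)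
  then have "grad f l = y" using I by (intro minimizer_grad[OF lK]) (force simp: g_def)
  then show ?thesis using that lK by blast
qed

end

section \<open>Duality for the composite problem\<close>

locale composite_problem = lh_barrier K f \<theta>
  for K :: "(real^'m) set" and f :: "real^'m \<Rightarrow> ereal" and \<theta> :: real +
  fixes A :: "real^'n \<Rightarrow> real^'m" and h :: "real^'n \<Rightarrow> ereal"
  assumes linear_A: "linear A" and h_pcc: "proper_closed_convex h"
    and A_dom: "A ` effdom h \<subseteq> K"
    and variation_bdd: "bdd_above (variation_set h)"
begin

definition primal_value :: "real^'n \<Rightarrow> real" where
  "primal_value x = fin f (A x) + fin h x"

lemma h_not_MInf: "h x \<noteq> - \<infinity>"
  using h_pcc by (auto simp: proper_closed_convex_def)

lemma h_eq_fin: "x \<in> effdom h \<Longrightarrow> h x = ereal (fin h x)"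
  using h_not_MInf[of x] by (auto simp: effdom_def ereal_real)

lemma variation_bound:
  assumes "x \<in> effdom h" "x' \<in> effdom h"
  shows "\<bar>fin h x - fin h x'\<bar> \<le> variation h"
  unfolding variation_def using assms variation_bdd
  by (intro cSup_upper) (auto simp: variation_set_def)

lemma h_convex:
  assumes "x \<in> effdom h" "x' \<in> effdom h" "0 \<le> t" "t \<le> 1"
  shows "(1 - t) *\<^sub>R x + t *\<^sub>R x' \<in> effdom h"
    and "fin h ((1 - t) *\<^sub>R x + t *\<^sub>R x') \<le> (1 - t) * fin h x + t * fin h x'"
proof -
  let ?x = "(1 - t) *\<^sub>R x + t *\<^sub>R x'"
  have "(x, fin h x) \<in> epi h" "(x', fin h x') \<in> epi h"
    using h_eq_fin[OF assms(1)] h_eq_fin[OF assms(2)] by (simp_all add: epi_def)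
  moreover have "convex (epi h)" using h_pcc by (auto simp: proper_closed_convex_def)
  ultimately have "(1 - t) *\<^sub>R (x, fin h x) + t *\<^sub>R (x', fin h x') \<in> epi h"
    using assms(3,4) by (intro convexD_alt) auto
  then have le: "h ?x \<le> ereal ((1 - t) * fin h x + t * fin h x')" by (simp add: epi_def)
  then show dom: "?x \<in> effdom h" by (auto simp: effdom_def)
  show "fin h ?x \<le> (1 - t) * fin h x + t * fin h x'"
    using le h_not_MInf[of ?x] by (cases "h ?x") auto
qed

lemma primal_obj_eq:
  "x \<in> effdom h \<Longrightarrow> A x \<in> interior K \<Longrightarrow> primal_obj f A h x = ereal (primal_value x)"
  unfolding primal_obj_def primal_value_def
  by (metis f_eq_fin h_eq_fin plus_ereal.simps(1))

lemma inner_A: "y \<bullet> A x + (- adjoint A y) \<bullet> x = 0"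
  by (simp add: adjoint_clauses(2)[OF linear_A])

lemma weak_duality:
  assumes "x \<in> effdom h" "A x \<in> interior K"
  shows "ereal (- primal_value x) \<le> dual_obj f A h v"
proof -
  have "ereal (v \<bullet> A x - fin f (A x)) \<le> conjugate f v" by (rule fenchel_young_f[OF assms(2)])
  moreover have "ereal ((- adjoint A v) \<bullet> x - fin h x) \<le> conjugate h (- adjoint A v)"
    using fenchel_young[of "- adjoint A v" x h] h_eq_fin[OF assms(1)] by (metis ereal_minus(1))
  ultimately have "ereal (v \<bullet> A x - fin f (A x)) + ereal ((- adjoint A v) \<bullet> x - fin h x) \<le> dual_obj f A h v"
    unfolding dual_obj_def by (rule add_mono)
  moreover have "v \<bullet> A x - fin f (A x) + ((- adjoint A v) \<bullet> x - fin h x) = - primal_value x"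
    using inner_A[of v x] unfolding primal_value_def by linarith
  ultimately show ?thesis by simp
qed

lemma weak_duality_primal:
  assumes "dual_obj f A h v = ereal c"
  shows "ereal (- c) \<le> primal_obj f A h x"
proof (cases "A x \<in> interior K \<and> x \<in> effdom h")
  case True
  then show ?thesis using weak_duality[of x v] assms by (simp add: primal_obj_eq)
next
  case False
  then have "f (A x) = \<infinity> \<or> h x = \<infinity>" using f_outside by (auto simp: effdom_def)
  then have "primal_obj f A h x = \<infinity>" by (auto simp: primal_obj_def)
  then show ?thesis by simp
qed

section \<open>One iteration as a Frank-Wolfe step\<close>

lemma md_g_eq:
  assumes "A x \<in> interior K"
  shows "md_g f A (grad f (A x)) s = A x - A s"
  by (simp add: md_g_def grad_conjugate[OF assms])

text \<open>The value \<open>G\<close> is the duality gap \<open>F(x) + d(y)\<close>, because the Fenchel-Young inequality is an equality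
  both for \<open>f\<close> at \<open>A x\<close> and for \<open>h\<close> at \<open>s\<close>.\<close>

lemma dual_obj_eq:
  assumes x: "A x \<in> interior K"
    and s: "s \<in> subdifferential (conjugate h) (- adjoint A (grad f (A x)))"
  shows "dual_obj f A h (grad f (A x)) = ereal (md_G f A h (grad f (A x)) x s - primal_value x)"
proof -
  let ?y = "grad f (A x)"
  have "conjugate h (- adjoint A ?y) = ereal ((- adjoint A ?y) \<bullet> s - fin h s)"
    by (rule fenchel_equality_of_conjugate_subgradient(2)[OF h_pcc s])
  then have "dual_obj f A h ?y = ereal (?y \<bullet> A x - fin f (A x) + ((- adjoint A ?y) \<bullet> s - fin h s))"
    by (simp add: dual_obj_def conjugate_at_grad[OF x])
  also have "?y \<bullet> A x - fin f (A x) + ((- adjoint A ?y) \<bullet> s - fin h s)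
      = md_G f A h ?y x s - primal_value x"
    using inner_A[of ?y s]
    by (simp add: md_G_def md_g_eq[OF x] primal_value_def inner_diff_left inner_diff_right inner_commute)
  finally show ?thesis .
qed

text \<open>By homogeneity \<open>- \<langle>y, A s\<rangle>\<close> equals \<open>G + \<theta> + h(s) - h(x)\<close>, which is at most \<open>G + \<theta> + R\<^sub>h\<close>.\<close>

lemma md_D_le:
  assumes x: "x \<in> effdom h" "A x \<in> interior K" and s: "s \<in> effdom h"
    and G: "0 \<le> md_G f A h (grad f (A x)) x s"
  shows "md_D f A (grad f (A x)) s \<le> md_G f A h (grad f (A x)) x s + (\<theta> + variation h)"
proof -
  let ?y = "grad f (A x)"
  have var: "\<bar>fin h x - fin h s\<bar> \<le> variation h" by (rule variation_bound[OF x(1) s])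
  have "md_G f A h ?y x s = - \<theta> - ?y \<bullet> A s + fin h x - fin h s"
    using grad_inner_self[OF x(2)]
    by (simp add: md_G_def md_g_eq[OF x(2)] inner_diff_left inner_diff_right inner_commute)
  then have "local_norm f (A x) (A s - A x) \<le> md_G f A h ?y x s + (\<theta> + variation h)"
    using var G A_dom s by (intro local_norm_diff_le[OF x(2)]) auto
  then show ?thesis
    by (simp add: md_D_def md_g_eq[OF x(2)] grad_conjugate[OF x(2)] local_norm_minus[of _ "A x"])
qed

lemma local_norm_scaleR: "0 \<le> c \<Longrightarrow> local_norm f u (c *\<^sub>R w) = c * local_norm f u w"
  by (simp add: local_norm_def matrix_vector_mult_scaleR real_sqrt_mult[symmetric] mult.assoc[symmetric])
    (simp add: real_sqrt_mult)

text \<open>Moving from \<open>x\<close> towards \<open>s\<close> by \<open>\<gamma>\<close> displaces \<open>A x\<close> by a vector of local norm \<open>\<gamma> D < 1\<close>, to which the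
  Dikin ellipsoid and the upper bound of self-concordance apply.\<close>

lemma frank_wolfe_step:
  assumes x: "x \<in> effdom h" "A x \<in> interior K" and s: "s \<in> effdom h"
  defines "y \<equiv> grad f (A x)"
  assumes G: "0 < md_G f A h y x s"
  defines "\<gamma> \<equiv> md_gamma f A h y x s"
  defines "x' \<equiv> (1 - \<gamma>) *\<^sub>R x + \<gamma> *\<^sub>R s"
  shows "0 < \<gamma>" "x' \<in> effdom h" "A x' \<in> interior K" "A x' = A x - \<gamma> *\<^sub>R md_g f A y s"
    and "primal_value x' \<le> primal_value x
      - (\<gamma> * md_G f A h y x s + \<gamma> * md_D f A y s + ln (1 - \<gamma> * md_D f A y s))"
proof -
  let ?G = "md_G f A h y x s" and ?D = "md_D f A y s"
  have D: "?D = local_norm f (A x) (A s - A x)"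
    by (simp add: y_def md_D_def md_g_eq[OF x(2)] grad_conjugate[OF x(2)] local_norm_minus[of _ "A x"])
  have D0: "0 \<le> ?D" unfolding D by (rule local_norm_nonneg[OF x(2)])
  have \<gamma>: "0 < \<gamma>" "\<gamma> \<le> 1" "\<gamma> * ?D < 1"
    using damped_step_bounds[OF G D0] unfolding \<gamma>_def md_gamma_def by auto
  show "0 < \<gamma>" by (rule \<gamma>(1))
  show "x' \<in> effdom h" unfolding x'_def using \<gamma> by (intro h_convex x s) auto
  define w where "w = \<gamma> *\<^sub>R (A s - A x)"
  have "A x' = (1 - \<gamma>) *\<^sub>R A x + \<gamma> *\<^sub>R A s"
    by (simp only: x'_def linear_add[OF linear_A] linear_scale[OF linear_A])
  then have Ax': "A x' = A x + w" by (simp add: w_def algebra_simps)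
  have w: "local_norm f (A x) w = \<gamma> * ?D" unfolding w_def D using \<gamma> by (intro local_norm_scaleR) auto
  show "A x' = A x - \<gamma> *\<^sub>R md_g f A y s"
    by (simp add: Ax' w_def y_def md_g_eq[OF x(2)] algebra_simps)
  show "A x' \<in> interior K" unfolding Ax' by (rule dikin[OF x(2)]) (simp add: w \<gamma>)
  have "fin f (A x') \<le> fin f (A x) + y \<bullet> w - \<gamma> * ?D - ln (1 - \<gamma> * ?D)"
    using self_concordant_upper_bound[OF x(2), of w] \<gamma>(3) by (simp add: w Ax' y_def)
  moreover have "fin h x' \<le> (1 - \<gamma>) * fin h x + \<gamma> * fin h s"
    unfolding x'_def using \<gamma> by (intro h_convex x s) auto
  moreover have "y \<bullet> w + ((1 - \<gamma>) * fin h x + \<gamma> * fin h s) = fin h x - \<gamma> * ?G"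
    by (simp add: w_def md_G_def y_def md_g_eq[OF x(2)] inner_diff_right inner_diff_left inner_commute algebra_simps)
  ultimately show "primal_value x' \<le> primal_value x - (\<gamma> * ?G + \<gamma> * ?D + ln (1 - \<gamma> * ?D))"
    unfolding primal_value_def by linarith
qed

text \<open>Up to constants and the factor \<open>1/\<gamma>\<close> the objective is \<open>f\<^sup>*(v) - \<langle>u', v\<rangle>\<close> with \<open>u' = u - \<gamma> g\<close>. The point
  \<open>\<nabla>f(u')\<close> attains the lower bound \<open>- f(u')\<close> of the Fenchel-Young inequality, so every minimizer attains it.\<close>

lemma mirror_step:
  assumes u: "u \<in> interior K" and \<gamma>: "0 < \<gamma>" and u': "u - \<gamma> *\<^sub>R g \<in> interior K"
    and min: "is_arg_min (\<lambda>v. ereal (g \<bullet> v) + inverse (ereal \<gamma>) * bregman (conjugate f) v (grad f u))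
      (\<lambda>_. True) y'"
  shows "y' = grad f (u - \<gamma> *\<^sub>R g)"
proof (rule grad_of_fenchel_equality[OF u'])
  define u' where "u' = u - \<gamma> *\<^sub>R g"
  let ?y = "grad f u" and ?v = "grad f u'"
  let ?obj = "\<lambda>v. ereal (g \<bullet> v) + inverse (ereal \<gamma>) * bregman (conjugate f) v ?y"
  have cy: "conjugate f ?y = ereal (?y \<bullet> u - fin f u)" by (rule conjugate_at_grad[OF u])
  have cv: "conjugate f ?v = ereal (?v \<bullet> u' - fin f u')" using u' by (simp add: u'_def conjugate_at_grad)
  have obj: "?obj v = ereal (g \<bullet> v + (c - (?y \<bullet> u - fin f u) - u \<bullet> (v - ?y)) / \<gamma>)"
    if "conjugate f v = ereal c" for v c
    using \<gamma> by (simp add: bregman_def that cy grad_conjugate[OF u] divide_inverse mult.commute)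
  have le: "?obj y' \<le> ?obj ?v" using min by (auto simp: is_arg_min_def not_less)
  obtain c where c: "conjugate f y' = ereal c"
  proof (cases "conjugate f y'")
    case PInf
    then have "bregman (conjugate f) y' ?y = \<infinity>" by (simp add: bregman_def cy)
    then have "?obj y' = \<infinity>" using \<gamma> by simp
    then show ?thesis using le by (simp only: obj[OF cv]) simp
  qed (use conjugate_not_MInf that in auto)
  define k where "k = ?y \<bullet> u - fin f u"
  have "g \<bullet> y' + (c - k - u \<bullet> (y' - ?y)) / \<gamma> \<le> g \<bullet> ?v + (?v \<bullet> u' - fin f u' - k - u \<bullet> (?v - ?y)) / \<gamma>"
    using le unfolding obj[OF c] obj[OF cv] k_def by simp
  from mult_left_mono[OF this, of \<gamma>]
  have "\<gamma> * (g \<bullet> y') + (c - k - u \<bullet> (y' - ?y)) \<le> \<gamma> * (g \<bullet> ?v) + (?v \<bullet> u' - fin f u' - k - u \<bullet> (?v - ?y))"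
    using \<gamma> by (simp add: distrib_left)
  then have "c \<le> y' \<bullet> u' - fin f u'"
    by (simp add: u'_def inner_diff_right inner_diff_left inner_commute)
  then show "conjugate f y' \<le> ereal (y' \<bullet> (u - \<gamma> *\<^sub>R g) - fin f (u - \<gamma> *\<^sub>R g))"
    by (simp add: c u'_def)
qed

end

section \<open>The iteration bound\<close>

theorem corollary1:
  fixes K :: "(real^'m) set"
    and f :: "real^'m \<Rightarrow> ereal"
    and A :: "real^'n \<Rightarrow> real^'m"
    and h :: "real^'n \<Rightarrow> ereal"
    and y :: "nat \<Rightarrow> real^'m"
    and z s :: "nat \<Rightarrow> real^'n"
    and ystar :: "real^'m"
    and \<theta> \<epsilon> Rh \<delta> :: real
    and Fstar :: ereal
    and d :: "nat \<Rightarrow> ereal"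
  assumes "regular_cone K"
    and "\<theta> \<ge> 1" and "lhscb \<theta> K f"
    and "linear A"
    and "proper_closed_convex h"
    and "effdom h \<noteq> {}" and "convex (effdom h)" and "compact (effdom h)"
    and "A ` effdom h \<inter> effdom f \<noteq> {}"
    and "A ` effdom h \<subseteq> K"
    and "bdd_above (variation_set h)" and "Rh = variation h"
    and "Fstar = (INF x. primal_obj f A h x)"
    and "\<forall>v. dual_obj f A h ystar \<le> dual_obj f A h v"
    and "mirror_descent K f A h y z s"
    and "\<And>k. d k = dual_obj f A h (y k) - dual_obj f A h ystar"
    and "\<delta> = real_of_ereal (primal_obj f A h (z 0) - Fstar)"
    and "\<epsilon> > 0"
  shows "iterations_to d \<epsilon> \<le>
    enat (nat (\<lceil>5.3 * (\<delta> + \<theta> + Rh) * ln (10.6 * \<delta>)\<rceil> + \<lceil>24 * (\<theta> + Rh)\<^sup>2 / \<epsilon>\<rceil>))"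
proof -
  interpret composite_problem K f \<theta> A h
    by (intro composite_problem.intro lh_barrier.intro composite_problem_axioms.intro assms)
  define B where "B = \<lceil>5.3 * (\<delta> + \<theta> + Rh) * ln (10.6 * \<delta>)\<rceil> + \<lceil>24 * (\<theta> + Rh)\<^sup>2 / \<epsilon>\<rceil>"
  define N where "N = nat B"
  define G where "G k = md_G f A h (y k) (z k) (s k)" for k
  define \<gamma> where "\<gamma> k = md_gamma f A h (y k) (z k) (s k)" for k
  note md = \<open>mirror_descent K f A h y z s\<close>[unfolded mirror_descent_def Let_def]
  have sub: "s k \<in> subdifferential (conjugate h) (- adjoint A (y k))" for k using md by blast
  have s_dom: "s k \<in> effdom h" for k by (rule fenchel_equality_of_conjugate_subgradient(1)[OF h_pcc sub])
  have z_Suc: "z (Suc k) = (1 - \<gamma> k) *\<^sub>R z k + \<gamma> k *\<^sub>R s k" for k using md by (auto simp: \<gamma>_def)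
  have y_Suc: "is_arg_min (\<lambda>v. ereal (md_g f A (y k) (s k) \<bullet> v)
      + inverse (ereal (\<gamma> k)) * bregman (conjugate f) v (y k)) (\<lambda>_. True) (y (Suc k))" for k
    using md by (auto simp: \<gamma>_def)
  \<comment> \<open>the invariant that identifies the dual iterate with the gradient of the barrier at the primal one\<close>
  define linked where "linked k \<longleftrightarrow> z k \<in> effdom h \<and> A (z k) \<in> interior K \<and> y k = grad f (A (z k))" for k
  have linked_0: "linked 0"
  proof -
    obtain u where u: "u \<in> interior K" "grad f u = y 0"
      using grad_surj_interior_polar md by metis
    then have "A (z 0) = u" using md grad_conjugate[OF u(1)] by simp
    then show ?thesis using u md by (simp add: linked_def)
  qed
  have dual_eq: "dual_obj f A h (y k) = ereal (G k - primal_value (z k))" if "linked k" for k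
    using that dual_obj_eq[of "z k" "s k"] sub[of k] by (auto simp: linked_def G_def)
  obtain dstar where dstar: "dual_obj f A h ystar = ereal dstar"
  proof -
    have "dual_obj f A h ystar \<le> ereal (G 0 - primal_value (z 0))"
      using assms(14) dual_eq[OF linked_0] by metis
    moreover have "ereal (- primal_value (z 0)) \<le> dual_obj f A h ystar"
      using weak_duality linked_0 by (simp add: linked_def)
    ultimately show ?thesis using that by (cases "dual_obj f A h ystar") auto
  qed
  have Fstar_le: "Fstar \<le> ereal (primal_value (z k))" if "linked k" for k
    using INF_lower[of "z k" UNIV "primal_obj f A h"] that primal_obj_eq[of "z k"]
    by (simp add: \<open>Fstar = _\<close> linked_def)
  have Fstar_ge: "ereal (- c) \<le> Fstar" if "dual_obj f A h v = ereal c" for v c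
    unfolding \<open>Fstar = _\<close> by (rule INF_greatest) (rule weak_duality_primal[OF that])
  obtain Fs where Fs: "Fstar = ereal Fs"
    using Fstar_le[OF linked_0] Fstar_ge[OF dstar] by (cases Fstar) auto
  define \<delta>' where "\<delta>' k = primal_value (z k) - Fs" for k
  have \<delta>0: "\<delta>' 0 = \<delta>"
    using linked_0 by (simp add: \<open>\<delta> = _\<close> \<delta>'_def Fs linked_def primal_obj_eq)
  have \<delta>_nonneg: "0 \<le> \<delta>' k" if "linked k" for k
    using Fstar_le[OF that] by (simp add: Fs \<delta>'_def)
  have \<delta>_le_G: "\<delta>' k \<le> G k" if "linked k" for k
    using Fstar_ge[OF dual_eq[OF that]] by (simp add: Fs \<delta>'_def)
  have d_le_G: "d k \<le> ereal (G k)" if "linked k" for k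
  proof -
    have "- primal_value (z k) \<le> dstar"
      using weak_duality[of "z k" ystar] that by (simp add: dstar linked_def)
    moreover have "d k = ereal (G k - primal_value (z k) - dstar)"
      by (simp only: \<open>\<And>k. d k = _\<close> dual_eq[OF that] dstar ereal_minus)
    ultimately show ?thesis by simp
  qed
  have step: "linked (Suc k) \<and> \<delta>' (Suc k) \<le> \<delta>' k
      - (\<gamma> k * G k + \<gamma> k * md_D f A (y k) (s k) + ln (1 - \<gamma> k * md_D f A (y k) (s k)))"
    if k: "linked k" "0 < G k" for k
  proof -
    have *: "z k \<in> effdom h" "A (z k) \<in> interior K" and yk: "grad f (A (z k)) = y k"
      using k by (auto simp: linked_def)
    note fw = frank_wolfe_step[OF * s_dom[of k], unfolded yk, folded G_def, OF k(2), folded \<gamma>_def z_Suc]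
    have "y (Suc k) = grad f (A (z (Suc k)))"
      unfolding fw(4)
      by (rule mirror_step[OF *(2) fw(1)]) (use fw(3,4) y_Suc yk in auto)
    then show ?thesis using fw by (simp add: linked_def \<delta>'_def)
  qed
  have Rh: "0 \<le> Rh" using variation_bound[OF s_dom[of 0] s_dom[of 0]] \<open>Rh = _\<close> by simp
  have "\<exists>k\<le>N. d k \<le> ereal \<epsilon>"
  proof (rule ccontr)
    assume "\<not> ?thesis"
    then have big: "ereal \<epsilon> < d k" if "k < Suc N" for k
      using that by (meson less_Suc_eq_le not_le)
    have G_big: "\<epsilon> < G k" if "linked k" "k < Suc N" for k
      using less_le_trans[OF big d_le_G] that by simp
    have link: "linked k" if "k \<le> Suc N" for k
      using that
    proof (induction k)
      case (Suc k)
      then have "linked k" "k < Suc N" by auto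
      then show ?case using step G_big \<open>\<epsilon> > 0\<close> by (meson less_trans)
    qed (rule linked_0)
    have G_pos: "0 < G k" if "k < Suc N" for k
      using G_big[OF link] that \<open>\<epsilon> > 0\<close> by (meson less_imp_le less_trans)
    have D0: "0 \<le> md_D f A (y k) (s k)" if "k < Suc N" for k
      using link[of k] that local_norm_nonneg grad_conjugate by (auto simp: md_D_def linked_def)
    have D_le: "md_D f A (y k) (s k) \<le> G k + (\<theta> + Rh)" if "k < Suc N" for k
      using md_D_le[of "z k" "s k"] link[of k] that s_dom G_pos[OF that]
      by (auto simp: linked_def G_def \<open>Rh = _\<close>)
    have \<Theta>: "1 \<le> \<theta> + Rh" using Rh \<open>\<theta> \<ge> 1\<close> by simp
    note dec = damped_step_decrease[OF G_pos D0 \<Theta> D_le, folded G_def]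
    have \<gamma>_eq: "\<gamma> k = md_step (G k) (md_D f A (y k) (s k))" for k
      by (simp add: \<gamma>_def md_gamma_def G_def)
    have "int (Suc N) \<le> \<lceil>5.3 * (\<delta>' 0 + (\<theta> + Rh)) * ln (10.6 * \<delta>' 0)\<rceil> + \<lceil>24 * (\<theta> + Rh)\<^sup>2 / \<epsilon>\<rceil>"
    proof (rule iteration_count[where G = G])
      fix k assume k: "k < Suc N"
      then have lk: "linked k" using link by simp
      note le = conjunct2[OF step[OF lk G_pos[OF k]], unfolded \<gamma>_eq]
      show "\<delta>' (Suc k) < \<delta>' k - G k / (5.3 * (G k + (\<theta> + Rh)))" if "\<theta> + Rh < G k"
        using le dec(1)[OF k k k that] by linarith
      show "\<delta>' (Suc k) \<le> \<delta>' k - (G k)\<^sup>2 / (12 * (\<theta> + Rh)\<^sup>2)" if "G k \<le> \<theta> + Rh"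
        using le dec(2)[OF k k k that] by linarith
    qed (use \<Theta> \<open>\<epsilon> > 0\<close> link \<delta>_nonneg \<delta>_le_G G_big in auto)
    then have "int (Suc N) \<le> B" by (simp only: \<delta>0 B_def add.assoc)
    then show False by (simp add: N_def split: if_splits)
  qed
  then obtain k where "k \<le> N" "d k \<le> ereal \<epsilon>" by blast
  then have "iterations_to d \<epsilon> \<le> enat N"
    unfolding iterations_to_def by (intro INF_lower2[of k]) auto
  then show ?thesis by (simp only: N_def B_def)
qed

end
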